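(* Let $(\mathcal{B},\|\cdot\|_{\mathcal{B}})$ be a separable and uniformly convex Banach space, let $k\in\mathbb{N}$, and let $X$ be a random element taking values in $\mathcal{B}$ with probability distribution $\mathrm{P}$ such that $\mathrm{E}\|X\|_{\mathcal{B}}^2<\infty$. Let $X_1,X_2,\ldots$ be independent observations drawn from $X$, let $\mathbb{P}_n=\frac1n\sum_{i=1}^n\delta_{X_i}$ be the empirical measure, and consider a sequence $(K_n)_{n\in\mathbb{N}}$ where $K_n\in\mathcal{S}_{\mathbb{P}_n}(k)$ is a $k$-means set of $\mathbb{P}_n$. Then: (i) Almost surely, any $d_H$-adherent point of the sequence $(K_n)$ belongs to $\mathcal{S}_{\mathrm{P}}(k)$. (ii) Suppose additionally that for any $K,K'\in\mathcal{S}_{\mathrm{P}}(k)$ there is an isometry $T:\mathcal{B}\to\mathcal{B}$ such that $T(K')=K$. Then, for any $K_0\in\mathcal{S}_{\mathrm{P}}(k)$, there is a subsequence $(K_{n_j})_{j\in\mathbb{N}}$ of $(K_n)$ such that $d_{GH}(K_{n_j},K_0)\to 0$ almost surely, as $j\to\infty$.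
   Context: For a probability measure $\mathrm{Q}$ on $\mathcal{B}$ and $a_1,\dots,a_k\in\mathcal{B}$, put $\Phi(\mathrm{Q};a_1,\dots,a_k)=\mathrm{E}_{\mathrm{Q}}\left(\min_{i=1,\dots,k}\|X-a_i\|_{\mathcal{B}}^2\right)$, the expectation being taken when $X$ has distribution $\mathrm{Q}$. A $k$-means set of $\mathrm{Q}$ is any subset of $\mathcal{B}$ of cardinality $k$ minimizing $\Phi(\mathrm{Q};a_1,\dots,a_k)$ over all possible sets $\{a_1,\dots,a_k\}\subset\mathcal{B}$. $\mathcal{S}_{\mathrm{Q}}(k)$ denotes the collection of all $k$-means sets of $\mathrm{Q}$. $\delta_a$ is the unit point mass at $a$. $\mathcal{H}(\mathcal{B})$ is the space of non-empty compact subsets of $\mathcal{B}$. For $A,C\in\mathcal{H}(\mathcal{B})$ the Hausdorff distance is $d_H(A,C)=\inf\{\varepsilon>0: A\subset C^\varepsilon\text{ and }C\subset A^\varepsilon\}$, where $B^\varepsilon=\bigcup_{x\in B}\{z:\|x-z\|\le\varepsilon\}$; the Hausdorff distance in a general metric space is defined analogously. A $d_H$-adherent point of a sequence in $\mathcal{H}(\mathcal{B})$ is a $d_H$-limit of some subsequence of it. The Gromov-Hausdorff metric is $d_{GH}(A,C)=\inf\{d_H(T(A),S(C))\}$ for $A,C\in\mathcal{H}(\mathcal{B})$, where the infimum ranges over all compact metric spaces $\mathcal{M}$ and all isometric embeddings $T:A\to\mathcal{M}$, $S:C\to\mathcal{M}$, and $d_H$ is here the Hausdorff distance in $\mathcal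{M}$.
   Formalization: A k-means set may have repeated centres (cardinality at most k, not exactly k); with exact cardinality (i) fails for P = δ_0, k = 2, K_n = {0,1/n}. The two notions agree for P unless P is carried by fewer than k points. *)

theory Defs
  imports "HOL-Probability.Probability"
begin

definition uniformly_convex :: "'a::real_normed_vector itself \<Rightarrow> bool" where
  "uniformly_convex _ \<longleftrightarrow>
     (\<forall>\<epsilon>>0. \<exists>\<delta>>0. \<forall>x y::'a. norm x = 1 \<longrightarrow> norm y = 1 \<longrightarrow> norm (x - y) \<ge> \<epsilon> \<longrightarrow>
        norm ((1/2) *\<^sub>R (x + y)) \<le> 1 - \<delta>)"

definition isometry :: "('a::metric_space \<Rightarrow> 'b::metric_space) \<Rightarrow> bool" where
  "isometry T \<longleftrightarrow> (\<forall>x y. dist (T x) (T y) = dist x y)"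


definition empirical_measure :: "nat \<Rightarrow> (nat \<Rightarrow> 'a::topological_space) \<Rightarrow> 'a measure" where
  "empirical_measure n x = distr (uniform_count_measure {1..n}) borel x"

lemma measure_empirical_measure:
  assumes "n \<ge> 1" "A \<in> sets borel"
  shows "measure (empirical_measure n x) A = (1 / n) * (\<Sum>i=1..n. measure (return borel (x i)) A)"
proof -
  have "measure (empirical_measure n x) A = card (x -` A \<inter> {1..n}) / n"
    using assms unfolding empirical_measure_def
    by (subst measure_distr)
       (auto simp: measurable_def space_uniform_count_measure sets_uniform_count_measure
          measure_uniform_count_measure)
  also have "real (card (x -` A \<inter> {1..n})) = (\<Sum>i=1..n. indicator A (x i))"
    by (subst Int_commute, simp add: sum.If_cases indicator_def vimage_def Int_def)
  finally show ?thesis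
    using assms by (simp add: measure_return)
qed


text \<open>The risk \<open>\<Phi>(Q; a\<^sub>1, \<dots>, a\<^sub>k)\<close>, with values in \<open>[0, \<infinity>]\<close>.\<close>

definition kmeans_risk :: "'a::real_normed_vector measure \<Rightarrow> nat \<Rightarrow> (nat \<Rightarrow> 'a) \<Rightarrow> ennreal" where
  "kmeans_risk Q k a = (\<integral>\<^sup>+x. ennreal (Min ((\<lambda>i. (norm (x - a i))\<^sup>2) ` {1..k})) \<partial>Q)"

text \<open>
  A \<open>k\<close>-means set is a set \<open>{a\<^sub>1, \<dots>, a\<^sub>k}\<close> of \<open>k\<close> centres, and repeated centres are allowed, as
  they are in the risk. This only matters if \<open>Q\<close> is carried by fewer than \<open>k\<close> points; otherwise
  it is the same as taking only sets of cardinality exactly \<open>k\<close>: see \<open>kmeans_sets_eq_distinct\<close>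
  below. For degenerate \<open>Q\<close> the class of minimising sets of cardinality exactly \<open>k\<close> is not closed
  under Hausdorff limits: if \<open>Q = \<delta>\<^sub>0\<close> and \<open>k = 2\<close>, then \<open>{0, 1/n}\<close> tends to \<open>{0}\<close>.
\<close>

definition kmeans_sets :: "'a::real_normed_vector measure \<Rightarrow> nat \<Rightarrow> 'a set set" where
  "kmeans_sets Q k = {a ` {1..k} | a. \<forall>b. kmeans_risk Q k a \<le> kmeans_risk Q k b}"

lemma kmeans_risk_mono:
  assumes "k \<ge> 1" "a ` {1..k} \<subseteq> b ` {1..k}"
  shows "kmeans_risk Q k b \<le> kmeans_risk Q k a"
  unfolding kmeans_risk_def
proof (intro nn_integral_mono ennreal_leI)
  fix x :: 'a
  have "(\<lambda>i. (norm (x - a i))\<^sup>2) ` {1..k} \<subseteq> (\<lambda>i. (norm (x - b i))\<^sup>2) ` {1..k}"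
    using image_mono[OF assms(2), of "\<lambda>c. (norm (x - c))\<^sup>2"] by (simp add: image_image)
  then show "Min ((\<lambda>i. (norm (x - b i))\<^sup>2) ` {1..k}) \<le> Min ((\<lambda>i. (norm (x - a i))\<^sup>2) ` {1..k})"
    using assms(1) by (intro Min_antimono) auto
qed

lemma borel_measurable_Min_dist:
  fixes a :: "nat \<Rightarrow> 'a::{real_normed_vector, second_countable_topology}"
  assumes "k \<ge> 1"
  shows "(\<lambda>x. Min ((\<lambda>i. (norm (x - a i))\<^sup>2) ` {1..k})) \<in> borel_measurable borel"
  by (rule borel_measurable_Min) auto

lemma kmeans_set_card:
  fixes Q :: "'a::{real_normed_vector, second_countable_topology} measure"
  assumes Q: "prob_space Q" "sets Q = sets borel"
    and moment: "(\<integral>\<^sup>+x. ennreal ((norm x)\<^sup>2) \<partial>Q) < \<infinity>"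
    and nondeg: "\<And>F. finite F \<Longrightarrow> card F < k \<Longrightarrow> measure Q F < 1"
    and min: "\<And>b. kmeans_risk Q k a \<le> kmeans_risk Q k b" and k: "k \<ge> 1"
  shows "card (a ` {1..k}) = k"
proof (rule ccontr)
  interpret Q: prob_space Q by fact
  define C where "C = a ` {1..k}"
  define f where "f = (\<lambda>x. Min ((\<lambda>c. (norm (x - c))\<^sup>2) ` C))"
  have finC: "finite C" "C \<noteq> {}" using k by (auto simp: C_def)
  assume "card (a ` {1..k}) \<noteq> k"
  then have cC: "card C < k"
    using card_image_le[of "{1..k}" a] by (auto simp: C_def)
  have spQ: "space Q = UNIV" using sets_eq_imp_space_eq[OF Q(2)] by simp
  have riskf: "kmeans_risk Q k a = (\<integral>\<^sup>+x. ennreal (f x) \<partial>Q)"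
    by (simp add: kmeans_risk_def f_def C_def image_image)
  have mq: "h \<in> borel_measurable Q" if "h \<in> borel_measurable borel" for h :: "'a \<Rightarrow> real"
    using that measurable_cong_sets[OF Q(2) refl, of "borel :: real measure"] by auto
  have fm: "f \<in> borel_measurable Q"
    using mq[OF borel_measurable_Min_dist[OF k, of a]] by (simp add: f_def C_def image_image)
  have f0: "f x \<ge> 0" for x unfolding f_def using finC by (subst Min_ge_iff) auto
  have fpos: "f x > 0" if "x \<notin> C" for x
    unfolding f_def using finC that by (subst Min_gr_iff) auto
  have "kmeans_risk Q k a \<le> kmeans_risk Q k (\<lambda>_. 0)" by (rule min)
  also have "\<dots> = (\<integral>\<^sup>+x. ennreal ((norm x)\<^sup>2) \<partial>Q)"
    using k by (simp add: kmeans_risk_def image_constant_conv)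
  finally have fin: "(\<integral>\<^sup>+x. ennreal (f x) \<partial>Q) \<noteq> \<infinity>" using moment riskf by auto
  obtain D :: "'a set" where D: "countable D" "\<And>U. open U \<Longrightarrow> U \<noteq> {} \<Longrightarrow> \<exists>d\<in>D. d \<in> U"
    using countable_dense_setE by metis
  define g where "g d x = min (f x) ((norm (x - d))\<^sup>2)" for d x
  have gm: "g d \<in> borel_measurable Q" for d
  proof -
    have "(\<lambda>x. (norm (x - d))\<^sup>2) \<in> borel_measurable Q" by (rule mq) measurable
    then show ?thesis unfolding g_def using fm by measurable
  qed
  have AEg: "AE x in Q. f x \<le> (norm (x - d))\<^sup>2" for d
  proof -
    define B where "B = insert d C"
    have "card B \<le> k" using cC finC by (simp add: B_def card_insert_if)
    moreover have "finite B" "B \<noteq> {}" using finC by (auto simp: B_def)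
    ultimately obtain b where b: "b ` {1..k} = B"
    proof -
      obtain h where h: "bij_betw h {1..card B} B"
        using ex_bij_betw_nat_finite_1[OF \<open>finite B\<close>] by auto
      have "(\<lambda>i. if i \<le> card B then h i else d) ` {1..k} = B"
      proof safe
        fix i assume "i \<in> {1..k}"
        then show "(if i \<le> card B then h i else d) \<in> B"
          using h by (auto simp: bij_betw_def B_def)
      next
        fix y assume "y \<in> B"
        then obtain i where "i \<in> {1..card B}" "y = h i"
          using h by (metis bij_betw_imp_surj_on imageE)
        then show "y \<in> (\<lambda>i. if i \<le> card B then h i else d) ` {1..k}"
          using \<open>card B \<le> k\<close> by (intro image_eqI[of _ _ i]) auto
      qed
      then show ?thesis using that by blast
    qed
    have "Min ((\<lambda>i. (norm (x - b i))\<^sup>2) ` {1..k}) = g d x" for x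
    proof -
      have "(\<lambda>i. (norm (x - b i))\<^sup>2) ` {1..k} = (\<lambda>c. (norm (x - c))\<^sup>2) ` B"
        by (simp add: b[symmetric] image_image)
      then show ?thesis using finC by (simp add: B_def g_def f_def min.commute)
    qed
    then have "kmeans_risk Q k b = (\<integral>\<^sup>+x. ennreal (g d x) \<partial>Q)"
      by (simp add: kmeans_risk_def)
    with min[of b] riskf have le: "(\<integral>\<^sup>+x. ennreal (f x) \<partial>Q) \<le> (\<integral>\<^sup>+x. ennreal (g d x) \<partial>Q)" by simp
    have gf: "AE x in Q. ennreal (g d x) \<le> ennreal (f x)"
      by (auto simp: g_def intro!: ennreal_leI)
    have "(\<integral>\<^sup>+x. ennreal (g d x) \<partial>Q) \<noteq> \<infinity>"
      using nn_integral_mono_AE[OF gf] fin by (auto simp: top_unique)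
    then have "(\<integral>\<^sup>+x. ennreal (f x) - ennreal (g d x) \<partial>Q) = 0"
      using le fm gm gf by (subst nn_integral_diff) (auto simp: ennreal_minus_eq_0 diff_eq_0_iff_ennreal less_top)
    then have "AE x in Q. ennreal (f x) - ennreal (g d x) = 0"
      using fm gm by (subst (asm) nn_integral_0_iff_AE) auto
    then show ?thesis
      by eventually_elim (auto simp: g_def ennreal_minus_eq_0 diff_eq_0_iff_ennreal ennreal_le_iff f0)
  qed
  have "AE x in Q. \<forall>d\<in>D. f x \<le> (norm (x - d))\<^sup>2"
    using D(1) AEg by (simp add: AE_ball_countable)
  then have "AE x in Q. x \<in> C"
  proof eventually_elim
    case (elim x)
    show ?case
    proof (rule ccontr)
      assume "x \<notin> C"
      then have "f x > 0" by (rule fpos)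
      then obtain d where d: "d \<in> D" "d \<in> ball x (sqrt (f x))"
        using D(2)[of "ball x (sqrt (f x))"] by auto
      then have "norm (x - d) < sqrt (f x)" by (simp add: dist_norm)
      then have "(norm (x - d))\<^sup>2 < f x"
        using \<open>f x > 0\<close> by (metis norm_ge_zero real_less_rsqrt not_less real_sqrt_le_iff real_sqrt_unique)
      with elim d(1) show False by force
    qed
  qed
  moreover have "C \<in> sets Q" using finC Q(2) by (auto intro: borel_closed finite_imp_closed)
  ultimately have "measure Q C = 1" by (subst Q.prob_eq_1) auto
  with nondeg[OF finC(1) cC] show False by simp
qed

lemma kmeans_sets_eq_distinct:
  fixes Q :: "'a::{real_normed_vector, second_countable_topology} measure"
  assumes "prob_space Q" "sets Q = sets borel" "(\<integral>\<^sup>+x. ennreal ((norm x)\<^sup>2) \<partial>Q) < \<infinity>"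
    and "\<And>F. finite F \<Longrightarrow> card F < k \<Longrightarrow> measure Q F < 1" and k: "k \<ge> 1"
  shows "kmeans_sets Q k = {a ` {1..k} | a. inj_on a {1..k} \<and>
           (\<forall>b. inj_on b {1..k} \<longrightarrow> kmeans_risk Q k a \<le> kmeans_risk Q k b)}"
    (is "?L = ?R")
proof
  show "?L \<subseteq> ?R"
  proof
    fix K assume "K \<in> ?L"
    then obtain a where a: "K = a ` {1..k}" "\<And>b. kmeans_risk Q k a \<le> kmeans_risk Q k b"
      by (auto simp: kmeans_sets_def)
    have "inj_on a {1..k}"
      using kmeans_set_card[OF assms(1-4) a(2) k] by (intro eq_card_imp_inj_on) auto
    with a show "K \<in> ?R" by blast
  qed
next
  show "?R \<subseteq> ?L"
  proof
    fix K assume "K \<in> ?R"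
    then obtain a where a: "K = a ` {1..k}" "inj_on a {1..k}"
      "\<And>b. inj_on b {1..k} \<Longrightarrow> kmeans_risk Q k a \<le> kmeans_risk Q k b"
      by blast
    have "kmeans_risk Q k a \<le> kmeans_risk Q k b" for b
    proof -
      let ?B = "b ` {1..k}"
      have "card ?B \<le> k" using card_image_le[of "{1..k}" b] by simp
      moreover have "k \<le> card (?B \<union> K)"
        using card_image[OF a(2)] a(1) card_mono[of "?B \<union> K" K] by simp
      ultimately obtain B' where B': "?B \<subseteq> B'" "card B' = k" "finite B'"
        using exists_subset_between[of ?B k "?B \<union> K"] a(1) by (metis Un_upper1 finite_UnI finite_atLeastAtMost finite_imageI finite_subset)
      obtain h where h: "bij_betw h {1..k} B'"
        using ex_bij_betw_nat_finite_1[OF B'(3)] B'(2) by auto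
      have "kmeans_risk Q k a \<le> kmeans_risk Q k h"
        using h by (intro a(3)) (auto simp: bij_betw_def)
      also have "\<dots> \<le> kmeans_risk Q k b"
        using h B'(1) k by (intro kmeans_risk_mono) (auto simp: bij_betw_def)
      finally show ?thesis .
    qed
    with a(1) show "K \<in> ?L" by (auto simp: kmeans_sets_def)
  qed
qed


text \<open>Hausdorff distance of subsets of the metric space with carrier \<open>M\<close> and metric \<open>d\<close>.\<close>

definition enlargement :: "'m set \<Rightarrow> ('m \<Rightarrow> 'm \<Rightarrow> real) \<Rightarrow> 'm set \<Rightarrow> real \<Rightarrow> 'm set" where
  "enlargement M d B \<epsilon> = (\<Union>x\<in>B. {z\<in>M. d x z \<le> \<epsilon>})"

definition hausdorff_dist :: "'m set \<Rightarrow> ('m \<Rightarrow> 'm \<Rightarrow> real) \<Rightarrow> 'm set \<Rightarrow> 'm set \<Rightarrow> real" where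
  "hausdorff_dist M d A C =
     Inf {\<epsilon>. \<epsilon> > 0 \<and> A \<subseteq> enlargement M d C \<epsilon> \<and> C \<subseteq> enlargement M d A \<epsilon>}"

abbreviation dH :: "'a::metric_space set \<Rightarrow> 'a set \<Rightarrow> real" where
  "dH \<equiv> hausdorff_dist UNIV dist"

definition hyperspace :: "'a::topological_space set set" where
  "hyperspace = {A. compact A \<and> A \<noteq> {}}"

definition dH_adherent_point :: "(nat \<Rightarrow> 'a::metric_space set) \<Rightarrow> 'a set \<Rightarrow> bool" where
  "dH_adherent_point S A \<longleftrightarrow>
     A \<in> hyperspace \<and> (\<exists>r::nat \<Rightarrow> nat. strict_mono r \<and> (\<lambda>j. dH (S (r j)) A) \<longlonglongrightarrow> 0)"


definition isometric_embedding ::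
    "'a::metric_space set \<Rightarrow> 'm set \<Rightarrow> ('m \<Rightarrow> 'm \<Rightarrow> real) \<Rightarrow> ('a \<Rightarrow> 'm) \<Rightarrow> bool" where
  "isometric_embedding A M d T \<longleftrightarrow> T ` A \<subseteq> M \<and> (\<forall>x\<in>A. \<forall>y\<in>A. d (T x) (T y) = dist x y)"

text \<open>
  The Hausdorff distances attained by isometric embeddings into compact metric spaces whose
  points are drawn from the type \<open>'m\<close>.
\<close>

definition gh_distances :: "'m itself \<Rightarrow> 'a::metric_space set \<Rightarrow> 'a set \<Rightarrow> real set" where
  "gh_distances _ A C =
     {hausdorff_dist M d (T ` A) (S ` C) | (M :: 'm set) d T S.
        Metric_space M d \<and> compact_space (Metric_space.mtopology M d) \<and>
        isometric_embedding A M d T \<and> isometric_embedding C M d S}"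

text \<open>
  A compact metric space has at most the cardinality of the continuum, so that it has an
  isometric copy whose points are real numbers (with a metric unrelated to the usual one).
  Hence spaces with points in \<^typ>\<open>real\<close> give all distances: see \<open>gh_distances_subset_real\<close> below.
\<close>

definition GH_dist :: "'a::metric_space set \<Rightarrow> 'a set \<Rightarrow> real" where
  "GH_dist A C = Inf (gh_distances TYPE(real) A C)"

lemma (in Metric_space) compact_space_inj_real:
  assumes "compact_space mtopology"
  obtains f :: "'a \<Rightarrow> real" where "inj_on f M"
proof -
  have tb: "mtotally_bounded M"
    using assms compactin_imp_mtotally_bounded[of M] by (simp add: compact_space_def)
  have "\<exists>F. finite F \<and> F \<subseteq> M \<and> M \<subseteq> (\<Union>x\<in>F. mball x (1 / Suc n))" for n
    using tb unfolding mtotally_bounded_def by (metis of_nat_0_less_iff zero_less_Suc zero_less_divide_1_iff)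
  then obtain F where F: "\<And>n. finite (F n)" "\<And>n. F n \<subseteq> M"
    "\<And>n. M \<subseteq> (\<Union>x\<in>F n. mball x (1 / Suc n))" by metis
  define D where "D = (\<Union>n. F n)"
  have D: "countable D" unfolding D_def using F(1) by (auto intro: countable_finite)
  define g where "g x = {m. d (from_nat_into D (fst (prod_decode m))) x < 1 / Suc (snd (prod_decode m))
      \<and> from_nat_into D (fst (prod_decode m)) \<in> M}" for x
  have "inj_on g M"
  proof (rule inj_onI, rule ccontr)
    fix x y assume xy: "x \<in> M" "y \<in> M" "g x = g y" "x \<noteq> y"
    then have "d x y > 0" by simp
    then obtain n where n: "1 / Suc n < d x y / 2"
      using nat_approx_posE[of "d x y / 2"] by auto
    from F(3) xy(1) obtain c where c: "c \<in> F n" "x \<in> mball c (1 / Suc n)" by blast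
    then have "c \<in> D" by (auto simp: D_def)
    then obtain i where i: "from_nat_into D i = c"
      using from_nat_into_to_nat_on[OF D] by blast
    have "prod_encode (i, n) \<in> g x" using c i by (auto simp: g_def)
    with xy(3) have "prod_encode (i, n) \<in> g y" by simp
    then have "d c y < 1 / Suc n" "c \<in> M" using i by (auto simp: g_def)
    moreover have "d c x < 1 / Suc n" using c by auto
    moreover have "d x y \<le> d c x + d c y"
      using triangle'[of x c y] xy \<open>c \<in> M\<close> commute by (metis triangle)
    ultimately show False using n by linarith
  qed
  moreover obtain h :: "nat set \<Rightarrow> real" where "inj h"
    using nat_sets_eqpoll_reals unfolding eqpoll_def bij_betw_def by blast
  ultimately have "inj_on (h \<circ> g) M"
    by (intro comp_inj_on) (auto intro: inj_on_subset)
  then show ?thesis using that by blast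
qed

lemma gh_distances_subset_real:
  fixes A C :: "'a::metric_space set"
  shows "gh_distances TYPE('m) A C \<subseteq> gh_distances TYPE(real) A C"
proof
  fix e assume "e \<in> gh_distances TYPE('m) A C"
  then obtain M :: "'m set" and d T S where M: "Metric_space M d"
    and cpt: "compact_space (Metric_space.mtopology M d)"
    and T: "isometric_embedding A M d T" and S: "isometric_embedding C M d S"
    and e: "e = hausdorff_dist M d (T ` A) (S ` C)"
    unfolding gh_distances_def by auto
  interpret Metric_space M d by fact
  obtain f :: "'m \<Rightarrow> real" where f: "inj_on f M"
    using compact_space_inj_real[OF cpt] .
  define f' where "f' = inv_into M f"
  have f'f: "f' (f x) = x" if "x \<in> M" for x using f that by (simp add: f'_def)
  define M' d' where "M' = f ` M" and "d' = (\<lambda>u v. d (f' u) (f' v))"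
  have M': "Metric_space M' d'"
    by unfold_locales (auto simp: M'_def d'_def f'f commute intro: triangle)
  interpret N: Metric_space M' d' by fact
  interpret MN: Metric_space12 M d M' d' by unfold_locales
  have "homeomorphic_map mtopology N.mtopology f"
    by (rule MN.isometry_imp_homeomorphic_map) (auto simp: M'_def d'_def f'f)
  then have cpt': "compact_space N.mtopology"
    using cpt homeomorphic_map_imp_homeomorphic_space homeomorphic_compact_space by blast
  have sub: "T ` A \<subseteq> M" "S ` C \<subseteq> M"
    using T S by (auto simp: isometric_embedding_def)
  have enl: "enlargement M' d' (f ` B) \<epsilon> = f ` enlargement M d B \<epsilon>" if "B \<subseteq> M" for B \<epsilon>
  proof -
    have "enlargement M' d' (f ` B) \<epsilon> = (\<Union>x\<in>B. f ` {z\<in>M. d x z \<le> \<epsilon>})"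
      unfolding enlargement_def using that
      by (auto simp: M'_def d'_def f'f subset_iff)
    then show ?thesis by (simp add: enlargement_def image_UN)
  qed
  have eM: "enlargement M d B \<epsilon> \<subseteq> M" for B \<epsilon> by (auto simp: enlargement_def)
  have "hausdorff_dist M' d' ((f \<circ> T) ` A) ((f \<circ> S) ` C) = e"
    unfolding hausdorff_dist_def e image_comp[symmetric] enl[OF sub(1)] enl[OF sub(2)]
    by (simp add: inj_on_image_subset_iff[OF f sub(1) eM] inj_on_image_subset_iff[OF f sub(2) eM])
  moreover have "isometric_embedding A M' d' (f \<circ> T)" "isometric_embedding C M' d' (f \<circ> S)"
    using T S by (auto simp: isometric_embedding_def M'_def d'_def f'f image_subset_iff)
  ultimately show "e \<in> gh_distances TYPE(real) A C"
    unfolding gh_distances_def using M' cpt' by blast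
qed

end

theory Submission
  imports Defs
begin

text \<open>
  Quantising the space by finitely many cells of small mean square error turns the convergence of the
  empirical risk into that of finitely many relative frequencies, uniformly over all sets of centres
  up to a factor near 1; for the quantisation error itself, a bound within a factor 2 of its mean is
  enough. Hence almost surely the empirical centres form a minimising sequence for the risk of the
  distribution. Along a subsequence such centres converge in norm, except for those that serve a null
  set in the limit, and the limits of the others already attain the infimum; this is where uniform
  convexity enters. If any two minimising sets are isometric, then no centre can be exceptional: it
  could be placed on top of another centre or away from all of them, which gives two minimising sets
  of different cardinalities. So the whole sequence converges in (ii).
\<close>

subsection \<open>Averages of independent, identically distributed variables\<close>

text \<open>Two obstacles shape the argument. Closed balls need not be compact, so even bounded
  centres need not have a convergent subsequence; bounded reals do, and so the distances from the
  points of a countable dense set to the centres are made to converge first, the centres only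
  afterwards. And \<open>K n\<close> is not assumed to depend measurably on the sample, so the
  exceptional null set has to be fixed before any centres are chosen: the probabilistic part
  concerns countably many cells and quantisation errors, and all that follows is about a fixed
  sequence of points. The comparison of true and empirical risk must be uniform in the centres in
  one direction only, for the empirical minimisers; for a fixed competitor \<open>b\<close>,
  convergence of the frequencies is enough. The factor near 1 comes from Young's inequality, whose
  other term is a multiple of the quantisation error. The mean of that error can be made as small as
  desired, so a lost factor 2 costs nothing.\<close>

lemma (in prob_space) variance_sum_indep_vars:
  fixes Y :: "'b \<Rightarrow> 'a \<Rightarrow> real"
  assumes fin: "finite I" and indep: "indep_vars (\<lambda>_. borel) Y I"
    and sq: "\<And>i. i \<in> I \<Longrightarrow> integrable M (\<lambda>\<omega>. (Y i \<omega>)\<^sup>2)"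
  shows "variance (\<lambda>\<omega>. \<Sum>i\<in>I. Y i \<omega>) = (\<Sum>i\<in>I. variance (Y i))"
    and "integrable M (\<lambda>\<omega>. (\<Sum>i\<in>I. Y i \<omega>)\<^sup>2)"
proof -
  have rv[measurable]: "Y i \<in> borel_measurable M" if "i \<in> I" for i
    using indep that by (auto simp: indep_vars_def)
  have int: "integrable M (Y i)" if "i \<in> I" for i
    by (rule square_integrable_imp_integrable) (use that sq in auto)
  define W where "W i \<omega> = Y i \<omega> - expectation (Y i)" for i \<omega>
  have Wint: "integrable M (W i)" if "i \<in> I" for i
    unfolding W_def using int[OF that] by auto
  have W0: "expectation (W i) = 0" if "i \<in> I" for i
    unfolding W_def using int[OF that] by (simp add: prob_space)
  have Wind: "indep_vars (\<lambda>_. borel) W I"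
    unfolding W_def by (rule indep_vars_compose2[OF indep]) auto
  have prod: "integrable M (\<lambda>\<omega>. W i \<omega> * W j \<omega>)" "expectation (\<lambda>\<omega>. W i \<omega> * W j \<omega>) = (if i = j then variance (Y i) else 0)"
    if "i \<in> I" "j \<in> I" for i j
  proof -
    have *: "integrable M (\<lambda>\<omega>. W i \<omega> * W j \<omega>) \<and> expectation (\<lambda>\<omega>. W i \<omega> * W j \<omega>) = (if i = j then variance (Y i) else 0)"
    proof (cases "i = j")
      case True
      have "integrable M (\<lambda>\<omega>. (Y i \<omega>)\<^sup>2 - 2 * expectation (Y i) * Y i \<omega> + (expectation (Y i))\<^sup>2)"
        using sq int that by auto
      then show ?thesis using True by (simp add: W_def power2_eq_square algebra_simps)
    next
      case False
      have iv: "indep_vars (\<lambda>_. borel) W {i, j}"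
        using that by (intro indep_vars_subset[OF Wind]) auto
      show ?thesis
        using indep_vars_integrable[OF _ iv] indep_vars_lebesgue_integral[OF _ iv] Wint W0 that False
        by auto
    qed
    then show "integrable M (\<lambda>\<omega>. W i \<omega> * W j \<omega>)" "expectation (\<lambda>\<omega>. W i \<omega> * W j \<omega>) = (if i = j then variance (Y i) else 0)" by auto
  qed
  have E: "expectation (\<lambda>\<omega>. \<Sum>i\<in>I. Y i \<omega>) = (\<Sum>i\<in>I. expectation (Y i))"
    using int by (simp add: integral_sum)
  have eq: "((\<Sum>i\<in>I. Y i \<omega>) - (\<Sum>i\<in>I. expectation (Y i)))\<^sup>2 = (\<Sum>i\<in>I. \<Sum>j\<in>I. W i \<omega> * W j \<omega>)" for \<omega>
    by (simp add: power2_eq_square W_def sum_subtractf[symmetric] sum_product)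
  show "variance (\<lambda>\<omega>. \<Sum>i\<in>I. Y i \<omega>) = (\<Sum>i\<in>I. variance (Y i))"
    unfolding E eq using prod fin by (simp add: integral_sum integrable_sum sum.If_cases Int_absorb1)
  \<comment> \<open>The square of the sum is recovered from the square of the centred sum by s^2 =
    (s - c)^2 + 2 c s - c^2.\<close>
  define c where "c = (\<Sum>i\<in>I. expectation (Y i))"
  have "integrable M (\<lambda>\<omega>. (\<Sum>i\<in>I. \<Sum>j\<in>I. W i \<omega> * W j \<omega>) + 2 * c * (\<Sum>i\<in>I. Y i \<omega>) - c\<^sup>2)"
    using prod int by (auto intro!: integrable_sum Bochner_Integration.integrable_diff Bochner_Integration.integrable_add)
  then show "integrable M (\<lambda>\<omega>. (\<Sum>i\<in>I. Y i \<omega>)\<^sup>2)"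
    unfolding eq[symmetric] c_def[symmetric] by (simp add: power2_eq_square algebra_simps)
qed

text \<open>The terms vanish until 2^j reaches \<open>y\<close> and are geometric from there on,
  with first term at most \<open>y\<close>. Integrated, this makes the Chebyshev bounds along the
  powers of 2 summable under a first moment alone.\<close>

lemma sum_truncated_squares_le:
  fixes y :: real
  assumes "y \<ge> 0"
  shows "(\<Sum>j<N. (if y \<le> 2 ^ j then y else 0)\<^sup>2 / 2 ^ j) \<le> 2 * y"
proof -
  \<comment> \<open>The bound is strengthened for the induction: the subtracted term is the exact
    tail of the geometric series from \<open>N\<close> on, and before 2^N reaches \<open>y\<close>
    all terms are zero.\<close>
  have "(\<Sum>j<N. (if y \<le> 2 ^ j then y else 0)\<^sup>2 / 2 ^ j) \<le> (if y \<le> 2 ^ N then 2 * y - 2 * y\<^sup>2 / 2 ^ N else 0)"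
  proof (induction N)
    case 0
    have "y * y \<le> y" if "y \<le> 1" using mult_left_le[OF that assms] by simp
    then show ?case by (auto simp: power2_eq_square)
  next
    case (Suc N)
    consider "y \<le> 2 ^ N" | "y > 2 ^ N" "y \<le> 2 ^ Suc N" | "y > 2 ^ Suc N" by linarith
    then show ?case
    proof cases
      case 1
      then have "y \<le> 2 ^ Suc N" using assms by (simp add: power_Suc)
      with 1 Suc show ?thesis by simp
    next
      case 2
      have "y * y \<le> 2 ^ Suc N * y" using 2(2) assms by (rule mult_right_mono)
      then have "2 * y\<^sup>2 / 2 ^ Suc N \<le> 2 * y" by (simp add: power2_eq_square field_simps)
      with 2 Suc show ?thesis by simp
    next
      case 3
      moreover have "(2::real) ^ N \<le> 2 ^ Suc N" by simp
      ultimately have "y > 2 ^ N" by linarith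
      with 3 Suc show ?thesis by simp
    qed
  qed
  also have "\<dots> \<le> 2 * y" using assms by auto
  finally show ?thesis .
qed

text \<open>A geometric sum is below twice its largest term. Integrated, this controls the sum over
  \<open>j\<close> of 2^j times the probability that one variable exceeds 2^j, that is, of the union
  bounds for a truncation that takes effect.\<close>

lemma sum_powers_below_le:
  fixes y :: real
  assumes "y \<ge> 0"
  shows "(\<Sum>j<N. 2 ^ j * (if y > 2 ^ j then 1 else 0)) \<le> 2 * y"
proof (induction N)
  case (Suc N)
  show ?case
  proof (cases "y > 2 ^ N")
    case True
    have "(\<Sum>j<Suc N. 2 ^ j * (if y > 2 ^ j then 1 else 0)) \<le> (\<Sum>j<Suc N. (2::real) ^ j)"
      by (intro sum_mono) auto
    also have "\<dots> = 2 ^ Suc N - 1" by (induction N) auto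
    also have "\<dots> \<le> 2 * y" using True by simp
    finally show ?thesis .
  qed (use Suc in simp)
qed (use assms in simp)

text \<open>
  Along the powers of 2, truncation and Chebyshev's inequality give the averages up to \<open>\<delta>\<close>; the
  factor 2 pays for passing to all \<open>n\<close>.
\<close>

lemma (in prob_space) iid_average_le_twice_mean:
  fixes Y :: "nat \<Rightarrow> 'a \<Rightarrow> real"
  assumes indep: "indep_vars (\<lambda>_. borel) Y {1..}"
    and distr: "\<And>i. i \<ge> 1 \<Longrightarrow> distr M borel (Y i) = distr M borel (Y 1)"
    and nonneg: "\<And>i \<omega>. Y i \<omega> \<ge> 0"
    and int: "integrable M (Y 1)" and \<delta>: "\<delta> > 0"
  shows "AE \<omega> in M. \<forall>\<^sub>F n in sequentially.
           (\<Sum>i=1..n. Y i \<omega>) \<le> 2 * (expectation (Y 1) + \<delta>) * n"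
proof -
  define E where "E = expectation (Y 1)"
  have rv[measurable]: "Y i \<in> borel_measurable M" if "i \<ge> 1" for i
    using indep that by (auto simp: indep_vars_def)
  have rv1[measurable]: "Y (Suc 0) \<in> borel_measurable M" using rv[of 1] by simp
  have E0: "E \<ge> 0" unfolding E_def using nonneg by simp
  \<comment> \<open>The block of 2^j variables is truncated at its own length; this balance is what
    makes both series below converge.\<close>
  define T where "T j y = (if y \<le> 2 ^ j then y else 0)" for j :: nat and y :: real
  have [measurable]: "T j \<in> borel_measurable borel" for j unfolding T_def by measurable
  have T0: "0 \<le> T j (Y i \<omega>)" "T j (Y i \<omega>) \<le> 2 ^ j" "T j (Y i \<omega>) \<le> Y i \<omega>" for i j \<omega>
    using nonneg by (auto simp: T_def)
  have same: "expectation (\<lambda>\<omega>. h (Y i \<omega>)) = expectation (\<lambda>\<omega>. h (Y 1 \<omega>))"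
    if "h \<in> borel_measurable borel" "i \<ge> 1" for h :: "real \<Rightarrow> real" and i
    using that distr[of i] integral_distr[of "Y i" M borel h] integral_distr[of "Y 1" M borel h] rv[of i] rv[of 1] by simp
  have Tint: "integrable M (\<lambda>\<omega>. T j (Y i \<omega>))" "integrable M (\<lambda>\<omega>. (T j (Y i \<omega>))\<^sup>2)" if "i \<ge> 1" for i j
  proof -
    have [measurable]: "Y i \<in> borel_measurable M" by (rule rv[OF that])
    show "integrable M (\<lambda>\<omega>. T j (Y i \<omega>))"
      by (rule integrable_const_bound[of _ "2 ^ j"]) (use T0 in auto)
    show "integrable M (\<lambda>\<omega>. (T j (Y i \<omega>))\<^sup>2)"
      by (rule integrable_const_bound[of _ "(2 ^ j)\<^sup>2"]) (use T0 in \<open>auto intro: power_mono\<close>)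
  qed
  define S where "S j \<omega> = (\<Sum>i\<in>{1..2 ^ j}. T j (Y i \<omega>))" for j \<omega>
  have [measurable]: "S j \<in> borel_measurable M" for j
    unfolding S_def using rv by (intro borel_measurable_sum) (auto intro!: measurable_compose[of _ M borel "T j" borel])
  have Tind: "indep_vars (\<lambda>_. borel) (\<lambda>i \<omega>. T j (Y i \<omega>)) {1..2 ^ j}" for j
    by (rule indep_vars_compose2[OF indep_vars_subset[OF indep]]) auto
  have ES: "expectation (S j) \<le> 2 ^ j * E" for j
  proof -
    have "expectation (S j) = (\<Sum>i\<in>{1..2 ^ j}. expectation (\<lambda>\<omega>. T j (Y i \<omega>)))"
      unfolding S_def using Tint by (subst Bochner_Integration.integral_sum) auto
    also have "\<dots> \<le> (\<Sum>i\<in>{1..(2::nat) ^ j}. E)"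
    proof (intro sum_mono)
      fix i assume "i \<in> {1..(2::nat) ^ j}"
      then have i: "i \<ge> 1" by simp
      have "expectation (\<lambda>\<omega>. T j (Y i \<omega>)) = expectation (\<lambda>\<omega>. T j (Y 1 \<omega>))" by (rule same[OF _ i]) simp
      also have "\<dots> \<le> E" unfolding E_def using Tint[of 1 j] int T0 by (intro integral_mono) auto
      finally show "expectation (\<lambda>\<omega>. T j (Y i \<omega>)) \<le> E" .
    qed
    finally show ?thesis by simp
  qed
  define V where "V j = expectation (\<lambda>\<omega>. (T j (Y 1 \<omega>))\<^sup>2)" for j
  have VS: "variance (S j) \<le> 2 ^ j * V j" for j
  proof -
    have "variance (S j) = (\<Sum>i\<in>{1..2 ^ j}. variance (\<lambda>\<omega>. T j (Y i \<omega>)))"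
      unfolding S_def by (rule variance_sum_indep_vars(1)[OF _ Tind]) (use Tint in auto)
    also have "\<dots> \<le> (\<Sum>i\<in>{1..(2::nat) ^ j}. V j)"
    proof (intro sum_mono)
      fix i assume "i \<in> {1..(2::nat) ^ j}"
      then have i: "i \<ge> 1" by simp
      have "variance (\<lambda>\<omega>. T j (Y i \<omega>)) \<le> expectation (\<lambda>\<omega>. (T j (Y i \<omega>))\<^sup>2)"
        using Tint[OF i, of j] by (subst variance_eq) auto
      also have "\<dots> = V j" unfolding V_def by (rule same[OF _ i]) simp
      finally show "variance (\<lambda>\<omega>. T j (Y i \<omega>)) \<le> V j" .
    qed
    finally show ?thesis by simp
  qed
  \<comment> \<open>Two ways to fail at stage \<open>j\<close>: the truncated sum deviates
    (\<open>A j\<close>), or the truncation changes a summand (\<open>B j\<close>). By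
    Borel-Cantelli, almost surely only finitely many failures occur.\<close>
  define A where "A j = {\<omega> \<in> space M. \<bar>S j \<omega> - expectation (S j)\<bar> \<ge> \<delta> * 2 ^ j}" for j
  define B where "B j = (\<Union>i\<in>{1..2 ^ j}. {\<omega> \<in> space M. Y i \<omega> > 2 ^ j})" for j :: nat
  have Am[measurable]: "A j \<in> sets M" for j unfolding A_def by measurable
  have Bm[measurable]: "B j \<in> sets M" for j unfolding B_def using rv by (intro sets.finite_UN) auto
  have PA: "prob (A j) \<le> V j / (\<delta>\<^sup>2 * 2 ^ j)" for j
  proof -
    have "prob (A j) \<le> variance (S j) / (\<delta> * 2 ^ j)\<^sup>2"
      unfolding A_def
      by (rule Chebyshev_inequality)
         (use \<delta> variance_sum_indep_vars(2)[OF _ Tind, of j] Tint in \<open>auto simp: S_def\<close>)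
    also have "\<dots> \<le> (2 ^ j * V j) / (\<delta> * 2 ^ j)\<^sup>2" using VS by (intro divide_right_mono) auto
    also have "\<dots> = V j / (\<delta>\<^sup>2 * 2 ^ j)" by (simp add: power2_eq_square)
    finally show ?thesis .
  qed
  \<comment> \<open>The union bound for \<open>B j\<close> is written as an expectation, so that
    \<open>sum_powers_below_le\<close> can be integrated.\<close>
  define U where "U j \<omega> = 2 ^ j * (if Y 1 \<omega> > 2 ^ j then 1 else 0 :: real)" for j :: nat and \<omega>
  have Uint: "integrable M (U j)" for j
    unfolding U_def by (rule integrable_const_bound[of _ "2 ^ j"]) auto
  have PB: "prob (B j) \<le> expectation (U j)" for j
  proof -
    define h :: "real \<Rightarrow> real" where "h y = (if y > 2 ^ j then 1 else 0)" for y
    have [measurable]: "h \<in> borel_measurable borel" unfolding h_def by measurable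
    have "prob (B j) \<le> (\<Sum>i\<in>{1..(2::nat) ^ j}. prob {\<omega> \<in> space M. Y i \<omega> > 2 ^ j})"
      unfolding B_def by (intro finite_measure_subadditive_finite) (use rv in auto)
    also have "\<dots> = (\<Sum>i\<in>{1..(2::nat) ^ j}. expectation (\<lambda>\<omega>. h (Y 1 \<omega>)))"
    proof (intro sum.cong refl)
      fix i assume "i \<in> {1..(2::nat) ^ j}"
      then have i: "i \<ge> 1" by simp
      have [measurable]: "Y i \<in> borel_measurable M" by (rule rv[OF i])
      have "prob {\<omega> \<in> space M. Y i \<omega> > 2 ^ j} = expectation (indicator {\<omega> \<in> space M. Y i \<omega> > 2 ^ j})"
        by simp
      also have "\<dots> = expectation (\<lambda>\<omega>. h (Y i \<omega>))"
        by (intro Bochner_Integration.integral_cong refl) (auto simp: h_def indicator_def)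
      also have "\<dots> = expectation (\<lambda>\<omega>. h (Y 1 \<omega>))" by (rule same[OF _ i]) simp
      finally show "prob {\<omega> \<in> space M. Y i \<omega> > 2 ^ j} = expectation (\<lambda>\<omega>. h (Y 1 \<omega>))" .
    qed
    also have "\<dots> = expectation (U j)" by (simp add: U_def[abs_def] h_def)
    finally show ?thesis .
  qed
  have "summable (\<lambda>j. V j / (\<delta>\<^sup>2 * 2 ^ j))"
  proof (rule summableI_nonneg_bounded)
    show "0 \<le> V j / (\<delta>\<^sup>2 * 2 ^ j)" for j by (simp add: V_def)
    fix N
    have "(\<Sum>j<N. V j / (\<delta>\<^sup>2 * 2 ^ j)) = (\<Sum>j<N. V j / 2 ^ j) / \<delta>\<^sup>2"
      by (simp add: sum_divide_distrib mult.commute)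
    also have "(\<Sum>j<N. V j / 2 ^ j) = expectation (\<lambda>\<omega>. \<Sum>j<N. (T j (Y 1 \<omega>))\<^sup>2 / 2 ^ j)"
      using Tint[of 1] unfolding V_def by (subst Bochner_Integration.integral_sum) auto
    also have "\<dots> \<le> expectation (\<lambda>\<omega>. 2 * Y 1 \<omega>)"
      using Tint[of 1] int sum_truncated_squares_le[OF nonneg]
      by (intro integral_mono) (auto simp: T_def)
    finally show "(\<Sum>j<N. V j / (\<delta>\<^sup>2 * 2 ^ j)) \<le> 2 * E / \<delta>\<^sup>2"
      by (simp add: E_def divide_right_mono)
  qed
  then have sA: "summable (\<lambda>j. prob (A j))"
    by (rule summable_comparison_test[rotated]) (use PA in auto)
  have "summable (\<lambda>j. expectation (U j))"
  proof (rule summableI_nonneg_bounded)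
    show "0 \<le> expectation (U j)" for j by (simp add: U_def)
    fix N
    have "(\<Sum>j<N. expectation (U j)) = expectation (\<lambda>\<omega>. \<Sum>j<N. U j \<omega>)"
      using Uint by (subst Bochner_Integration.integral_sum) auto
    also have "\<dots> \<le> expectation (\<lambda>\<omega>. 2 * Y 1 \<omega>)"
    proof (rule integral_mono)
      show "(\<Sum>j<N. U j \<omega>) \<le> 2 * Y 1 \<omega>" for \<omega>
        using sum_powers_below_le[OF nonneg] by (simp add: U_def)
    qed (use Uint int in auto)
    finally show "(\<Sum>j<N. expectation (U j)) \<le> 2 * E" by (simp add: E_def)
  qed
  then have sB: "summable (\<lambda>j. prob (B j))"
    by (rule summable_comparison_test[rotated]) (use PB in auto)
  have "AE \<omega> in M. \<forall>\<^sub>F j in sequentially. \<omega> \<in> space M - A j"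
    by (rule borel_cantelli_AE1) (use sA in \<open>auto simp: less_top[symmetric]\<close>)
  moreover have "AE \<omega> in M. \<forall>\<^sub>F j in sequentially. \<omega> \<in> space M - B j"
    by (rule borel_cantelli_AE1) (use sB in \<open>auto simp: less_top[symmetric]\<close>)
  ultimately show ?thesis
  proof eventually_elim
    case (elim \<omega>)
    from eventually_conj[OF elim] obtain J where J: "\<And>j. j \<ge> J \<Longrightarrow> \<omega> \<in> space M - A j \<and> \<omega> \<in> space M - B j"
      by (auto simp: eventually_sequentially)
    have dy: "(\<Sum>i\<in>{1..2 ^ j}. Y i \<omega>) \<le> (E + \<delta>) * 2 ^ j" if "j \<ge> J" for j
    proof -
      have "(\<Sum>i\<in>{1..2 ^ j}. Y i \<omega>) = S j \<omega>"
        unfolding S_def T_def using J[OF that] by (intro sum.cong) (auto simp: B_def not_less)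
      also have "\<dots> \<le> expectation (S j) + \<delta> * 2 ^ j" using J[OF that] by (auto simp: A_def)
      also have "\<dots> \<le> (E + \<delta>) * 2 ^ j" using ES[of j] by (simp add: algebra_simps)
      finally show ?thesis .
    qed
    show ?case
      unfolding eventually_sequentially
    \<comment> \<open>The first power of 2 that reaches \<open>n\<close> is at most
      \<open>2 * n\<close>, and nonnegative summands allow the sum to be extended up to it. The
      \<open>+ 1\<close> forces \<open>J < j\<close>, so that \<open>j\<close> has a
      predecessor.\<close>
    proof (intro exI[of _ "2 ^ J + 1"] allI impI)
      fix n :: nat assume n: "2 ^ J + 1 \<le> n"
      define j where "j = (LEAST j. n \<le> 2 ^ j)"
      have nj: "n \<le> 2 ^ j" unfolding j_def by (rule LeastI[of _ n]) (simp add: less_imp_le)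
      have "J < j" using n nj by (metis Suc_eq_plus1 Suc_leD leD le_trans linorder_not_le not_less_eq_eq power_increasing one_le_numeral)
      then obtain j' where j': "j = Suc j'" by (cases j) auto
      have "\<not> n \<le> 2 ^ j'" unfolding j_def using j' j_def not_less_Least[of j' "\<lambda>j. n \<le> 2 ^ j"] by auto
      then have "2 ^ j \<le> 2 * n" by (simp add: j')
      then have 2: "(2::real) ^ j \<le> 2 * n" by (metis of_nat_le_iff of_nat_mult of_nat_numeral of_nat_power)
      have "(\<Sum>i=1..n. Y i \<omega>) \<le> (\<Sum>i\<in>{1..2 ^ j}. Y i \<omega>)"
        using nj nonneg by (intro sum_mono2) auto
      also have "\<dots> \<le> (E + \<delta>) * 2 ^ j" using dy \<open>J < j\<close> by simp
      also have "\<dots> \<le> (E + \<delta>) * (2 * n)" using 2 E0 \<delta> by (intro mult_left_mono) auto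
      finally show "(\<Sum>i=1..n. Y i \<omega>) \<le> 2 * (expectation (Y 1) + \<delta>) * n"
        by (simp add: E_def algebra_simps)
    qed
  qed
qed

text \<open>Indicators are bounded, so Hoeffding's inequality makes the deviation probabilities
  decay geometrically in \<open>n\<close>, and Borel-Cantelli applies to the whole sequence at
  once.\<close>

lemma (in prob_space) iid_relative_frequency_tendsto:
  fixes Xs :: "nat \<Rightarrow> 'a \<Rightarrow> 'b::topological_space"
  assumes indep: "indep_vars (\<lambda>_. borel) Xs {1..}"
    and distr: "\<And>i. i \<ge> 1 \<Longrightarrow> distr M borel (Xs i) = P"
    and A[measurable]: "A \<in> sets borel"
  shows "AE \<omega> in M. (\<lambda>n. (\<Sum>i=1..n. indicator A (Xs i \<omega>)) / n) \<longlonglongrightarrow> measure P A"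
proof -
  have rv[measurable]: "Xs i \<in> borel_measurable M" if "i \<ge> 1" for i
    using indep that by (auto simp: indep_vars_def)
  have rv1[measurable]: "Xs (Suc 0) \<in> borel_measurable M" using rv[of 1] by simp
  define W :: "nat \<Rightarrow> 'a \<Rightarrow> real" where "W i \<omega> = indicator A (Xs i \<omega>)" for i \<omega>
  have Wm[measurable]: "W i \<in> borel_measurable M" if "i \<ge> 1" for i
    unfolding W_def using measurable_compose[OF rv[OF that] borel_measurable_indicator[OF A]] .
  have Wm1[measurable]: "W (Suc 0) \<in> borel_measurable M" using Wm[of 1] by simp
  have Wind: "indep_vars (\<lambda>_. borel) W {1..}"
    unfolding W_def by (rule indep_vars_compose2[OF indep]) auto
  have Wd: "distr M borel (W i) = distr P borel (indicator A)" if "i \<ge> 1" for i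
    using distr_distr[of "indicator A :: 'b \<Rightarrow> real" borel borel, OF _ rv[OF that]] distr[OF that]
    by (simp add: W_def[abs_def] comp_def)
  have EW: "expectation (W 1) = measure P A"
  proof -
    have "expectation (W 1) = prob (Xs 1 -` A \<inter> space M)"
    proof -
      have "expectation (W 1) = expectation (indicator (Xs 1 -` A \<inter> space M))"
        by (intro Bochner_Integration.integral_cong refl) (auto simp: W_def indicator_def)
      then show ?thesis using rv1 by simp
    qed
    also have "\<dots> = measure (distr M borel (Xs 1)) A" using rv1 by (subst measure_distr) auto
    finally show ?thesis using distr[of 1] by simp
  qed
  have conv: "AE \<omega> in M. \<forall>\<^sub>F n in sequentially. \<bar>(\<Sum>i=1..n. W i \<omega>) / n - measure P A\<bar> < \<epsilon>"
    if \<epsilon>: "\<epsilon> > 0" for \<epsilon>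
  proof -
    define C where "C n = {\<omega> \<in> space M. n \<ge> 1 \<and> \<bar>(\<Sum>i=1..n. W i \<omega>) / n - measure P A\<bar> \<ge> \<epsilon>}" for n :: nat
    have [measurable]: "C n \<in> sets M" for n
    proof -
      have [measurable]: "(\<lambda>\<omega>. \<Sum>i=1..n. W i \<omega>) \<in> borel_measurable M" using Wm by (intro borel_measurable_sum) auto
      show ?thesis unfolding C_def by measurable
    qed
    have PC: "prob (C n) \<le> 2 * exp (- 2 * \<epsilon>\<^sup>2) ^ n" for n
    proof (cases "n \<ge> 1")
      case True
      interpret H: Hoeffding_ineq_iid M "{1..n}" W "W 1" 0 1 "measure P A"
      proof (unfold_locales)
        show "indep_vars (\<lambda>_. borel) W {1..n}" by (rule indep_vars_subset[OF Wind]) auto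
        show "distr M borel (W i) = distr M borel (W 1)" if "i \<in> {1..n}" for i using that Wd[of i] Wd[of 1] by simp
        show "measure P A \<equiv> expectation (W 1)" using EW by simp
      qed (auto simp: W_def indicator_def)
      have "prob (C n) = prob {\<omega> \<in> space M. \<bar>(\<Sum>i=1..n. W i \<omega>) / n - measure P A\<bar> \<ge> \<epsilon>}"
        using True by (simp add: C_def)
      also have "\<dots> \<le> 2 * exp (-2 * n * \<epsilon>\<^sup>2 / (1 - 0)\<^sup>2)"
        using H.Hoeffding_ineq_abs_ge'[of \<epsilon>] \<epsilon> True by simp
      also have "exp (-2 * n * \<epsilon>\<^sup>2 / (1 - 0)\<^sup>2) = exp (- 2 * \<epsilon>\<^sup>2) ^ n"
        by (simp add: exp_of_nat_mult[symmetric] algebra_simps)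
      finally show ?thesis .
    qed (simp add: C_def)
    have "summable (\<lambda>n. 2 * exp (- 2 * \<epsilon>\<^sup>2) ^ n)"
      using \<epsilon> by (intro summable_mult summable_geometric) auto
    then have "summable (\<lambda>n. prob (C n))"
      by (rule summable_comparison_test[rotated]) (use PC in auto)
    then have "AE \<omega> in M. \<forall>\<^sub>F n in sequentially. \<omega> \<in> space M - C n"
      by (intro borel_cantelli_AE1) (auto simp: less_top[symmetric])
    then show ?thesis
    proof eventually_elim
      case (elim \<omega>)
      with eventually_ge_at_top[of 1] show ?case
        by eventually_elim (auto simp: C_def)
    qed
  qed
  have "AE \<omega> in M. \<forall>m::nat. \<forall>\<^sub>F n in sequentially. \<bar>(\<Sum>i=1..n. W i \<omega>) / n - measure P A\<bar> < 1 / Suc m"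
    unfolding AE_all_countable using conv by simp
  then show ?thesis
  proof eventually_elim
    case (elim \<omega>)
    show ?case
    proof (rule tendstoI)
      fix e :: real assume "e > 0"
      then obtain m where m: "1 / real (Suc m) < e" using nat_approx_posE by auto
      from elim have "\<forall>\<^sub>F n in sequentially. \<bar>(\<Sum>i=1..n. W i \<omega>) / n - measure P A\<bar> < 1 / Suc m" by blast
      then show "\<forall>\<^sub>F n in sequentially. dist ((\<Sum>i=1..n. indicator A (Xs i \<omega>)) / n) (measure P A) < e"
        by eventually_elim (use m in \<open>auto simp: W_def dist_real_def\<close>)
    qed
  qed
qed

subsection \<open>The risk and its empirical counterpart\<close>

text \<open>The integrand of \<open>kmeans_risk\<close>, kept real so that finite risks can be
  compared as Bochner integrals.\<close>

definition sqdist :: "nat \<Rightarrow> (nat \<Rightarrow> 'a::real_normed_vector) \<Rightarrow> 'a \<Rightarrow> real" where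
  "sqdist k a x = Min ((\<lambda>i. (norm (x - a i))\<^sup>2) ` {1..k})"

lemma sqdist_le: "i \<in> {1..k} \<Longrightarrow> sqdist k a x \<le> (norm (x - a i))\<^sup>2"
  unfolding sqdist_def by (intro Min_le) auto

lemma sqdist_attained:
  assumes "k \<ge> 1"
  obtains i where "i \<in> {1..k}" "sqdist k a x = (norm (x - a i))\<^sup>2"
proof -
  have "sqdist k a x \<in> (\<lambda>i. (norm (x - a i))\<^sup>2) ` {1..k}"
    unfolding sqdist_def using assms by (intro Min_in) auto
  then show ?thesis using that by blast
qed

lemma sqdist_nonneg: "k \<ge> 1 \<Longrightarrow> sqdist k a x \<ge> 0"
  by (metis sqdist_attained zero_le_power2)

lemma borel_measurable_sqdist[measurable]:
  fixes a :: "nat \<Rightarrow> 'a::{real_normed_vector, second_countable_topology}"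
  shows "sqdist k a \<in> borel_measurable borel"
proof (cases "k \<ge> 1")
  case True
  then show ?thesis using borel_measurable_Min_dist[of k a] by (simp add: sqdist_def[abs_def])
qed (simp add: sqdist_def[abs_def])

text \<open>Young's inequality 2 p q <= h p^2 + q^2 / h. A small \<open>h\<close> keeps the first
  factor near 1, at the price of a large factor on a term \<open>v\<close> that will itself be
  small.\<close>

lemma norm_add_squared_le:
  fixes u v :: "'a::real_normed_vector"
  assumes "h > 0"
  shows "(norm (u + v))\<^sup>2 \<le> (1 + h) * (norm u)\<^sup>2 + (1 + 1 / h) * (norm v)\<^sup>2"
proof -
  define p q where "p = norm u" and "q = norm v"
  have "(norm (u + v))\<^sup>2 \<le> (p + q)\<^sup>2"
    unfolding p_def q_def by (intro power_mono norm_triangle_ineq) auto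
  also have "(1 + h) * p\<^sup>2 + (1 + 1 / h) * q\<^sup>2 - (p + q)\<^sup>2 = (h * p - q)\<^sup>2 / h"
    using assms by (simp add: field_simps power2_eq_square)
  then have "(p + q)\<^sup>2 \<le> (1 + h) * p\<^sup>2 + (1 + 1 / h) * q\<^sup>2"
    using assms by (metis diff_ge_0_iff_ge divide_nonneg_pos zero_le_power2)
  finally show ?thesis by (simp add: p_def q_def)
qed

text \<open>The index that is best for \<open>y\<close> under \<open>a\<close> is tried for
  \<open>x\<close> under \<open>b\<close>. If \<open>a\<close> and \<open>b\<close> agree, the
  perturbation is just \<open>x - y\<close>, whatever the centres are, which is the source of all
  uniformity over centres.\<close>

lemma sqdist_le_perturbed:
  assumes "k \<ge> 1" "h > 0" "\<And>i. i \<in> {1..k} \<Longrightarrow> norm ((x - b i) - (y - a i)) \<le> e"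
  shows "sqdist k b x \<le> (1 + h) * sqdist k a y + (1 + 1 / h) * e\<^sup>2"
proof -
  obtain i where i: "i \<in> {1..k}" "sqdist k a y = (norm (y - a i))\<^sup>2"
    using sqdist_attained[OF assms(1)] .
  have "sqdist k b x \<le> (norm ((y - a i) + ((x - b i) - (y - a i))))\<^sup>2"
    using sqdist_le[OF i(1), of b x] by simp
  also have "\<dots> \<le> (1 + h) * (norm (y - a i))\<^sup>2 + (1 + 1 / h) * (norm ((x - b i) - (y - a i)))\<^sup>2"
    by (rule norm_add_squared_le) fact
  also have "\<dots> \<le> (1 + h) * sqdist k a y + (1 + 1 / h) * e\<^sup>2"
    using assms i by (intro add_mono mult_left_mono power_mono) auto
  finally show ?thesis .
qed

section \<open>Distributions with finite second moment\<close>

locale square_integrable_distribution = prob_space P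
  for P :: "'a::{banach, second_countable_topology} measure" +
  assumes sets_P[measurable_cong]: "sets P = sets borel"
    and moment: "integrable P (\<lambda>x. (norm x)\<^sup>2)"
begin

lemma space_P: "space P = UNIV"
  using sets_eq_imp_space_eq[OF sets_P] by simp

lemma integrable_norm_diff: "integrable P (\<lambda>x. (norm (x - c))\<^sup>2)"
proof (rule Bochner_Integration.integrable_bound)
  show "integrable P (\<lambda>x. 2 * (norm x)\<^sup>2 + 2 * (norm c)\<^sup>2)"
    using moment by auto
  show "AE x in P. norm ((norm (x - c))\<^sup>2) \<le> norm (2 * (norm x)\<^sup>2 + 2 * (norm c)\<^sup>2)"
    using norm_add_squared_le[of 1 _ "- c"] by (auto intro!: AE_I2)
qed measurable

lemma integrable_sqdist: "integrable P (sqdist k a)" if "k \<ge> 1"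
proof (rule Bochner_Integration.integrable_bound[OF integrable_norm_diff[of "a 1"]])
  show "AE x in P. norm (sqdist k a x) \<le> norm ((norm (x - a 1))\<^sup>2)"
    using that sqdist_le[of 1 k a] sqdist_nonneg[of k a] by auto
qed measurable

lemma kmeans_risk_eq: "kmeans_risk P k a = ennreal (\<integral>x. sqdist k a x \<partial>P)" if "k \<ge> 1"
  unfolding kmeans_risk_def sqdist_def[symmetric]
  using integrable_sqdist[OF that] sqdist_nonneg[OF that] by (intro nn_integral_eq_integral) auto

lemma kmeans_risk_le_iff:
  "kmeans_risk P k a \<le> kmeans_risk P k b \<longleftrightarrow> (\<integral>x. sqdist k a x \<partial>P) \<le> (\<integral>x. sqdist k b x \<partial>P)" if "k \<ge> 1"
proof -
  have "0 \<le> (\<integral>x. sqdist k b x \<partial>P)"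
    using sqdist_nonneg[OF that] by (intro integral_nonneg_AE) auto
  then show ?thesis by (simp add: kmeans_risk_eq[OF that] ennreal_le_iff)
qed

end

lemma kmeans_risk_empirical_measure:
  fixes x :: "nat \<Rightarrow> 'a::{real_normed_vector, second_countable_topology}"
  assumes "n \<ge> 1" "k \<ge> 1"
  shows "kmeans_risk (empirical_measure n x) k a = ennreal ((\<Sum>i=1..n. sqdist k a (x i)) / n)"
proof -
  have "kmeans_risk (empirical_measure n x) k a = (\<integral>\<^sup>+y. ennreal (sqdist k a y) \<partial>empirical_measure n x)"
    by (simp add: kmeans_risk_def sqdist_def)
  also have "\<dots> = (\<integral>\<^sup>+i. ennreal (sqdist k a (x i)) \<partial>uniform_count_measure {1..n})"
    unfolding empirical_measure_def
    by (subst nn_integral_distr)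
       (auto simp: measurable_def[of "uniform_count_measure A" for A] space_uniform_count_measure sets_uniform_count_measure)
  also have "\<dots> = (\<Sum>i=1..n. ennreal (sqdist k a (x i)) * ennreal (1 / n))"
    unfolding uniform_count_measure_def
    by (subst nn_integral_point_measure_finite) (auto simp: ac_simps)
  also have "\<dots> = (\<Sum>i=1..n. ennreal (sqdist k a (x i) / n))"
    using sqdist_nonneg[OF assms(2)] by (intro sum.cong refl) (subst ennreal_mult[symmetric], auto)
  also have "\<dots> = ennreal ((\<Sum>i=1..n. sqdist k a (x i)) / n)"
    by (subst sum_ennreal) (auto simp: sqdist_nonneg[OF assms(2)] sum_divide_distrib)
  finally show ?thesis .
qed

lemma kmeans_set_empirical_measureE:
  fixes x :: "nat \<Rightarrow> 'a::{real_normed_vector, second_countable_topology}"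
  assumes "n \<ge> 1" "k \<ge> 1" "K \<in> kmeans_sets (empirical_measure n x) k"
  obtains a where "K = a ` {1..k}"
    and "\<And>b. (\<Sum>i=1..n. sqdist k a (x i)) \<le> (\<Sum>i=1..n. sqdist k b (x i))"
proof -
  obtain a where a: "K = a ` {1..k}"
    and "\<And>b. kmeans_risk (empirical_measure n x) k a \<le> kmeans_risk (empirical_measure n x) k b"
    using assms(3) by (auto simp: kmeans_sets_def)
  moreover have "0 \<le> (\<Sum>i=1..n. sqdist k b (x i)) / n" for b
    using sqdist_nonneg[OF assms(2)] by (intro divide_nonneg_nonneg sum_nonneg) auto
  ultimately have "(\<Sum>i=1..n. sqdist k a (x i)) / n \<le> (\<Sum>i=1..n. sqdist k b (x i)) / n" for b
    by (simp add: kmeans_risk_empirical_measure[OF assms(1,2)] del: sum_divide_distrib[symmetric])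
  then have "(\<Sum>i=1..n. sqdist k a (x i)) \<le> (\<Sum>i=1..n. sqdist k b (x i))" for b
    using assms(1) by (simp add: divide_le_cancel)
  with a that show ?thesis by blast
qed

section \<open>Quantisation by an initial piece of a dense sequence\<close>

definition nearest :: "(nat \<Rightarrow> 'a::real_normed_vector) \<Rightarrow> nat \<Rightarrow> 'a \<Rightarrow> nat" where
  "nearest d m x = (LEAST j. j \<le> m \<and> (\<forall>i\<le>m. norm (x - d j) \<le> norm (x - d i)))"

definition quantization_error :: "(nat \<Rightarrow> 'a::real_normed_vector) \<Rightarrow> nat \<Rightarrow> 'a \<Rightarrow> real" where
  "quantization_error d m x = (norm (x - d (nearest d m x)))\<^sup>2"

lemma nearest:
  shows nearest_le: "nearest d m x \<le> m"
    and norm_nearest_le: "i \<le> m \<Longrightarrow> norm (x - d (nearest d m x)) \<le> norm (x - d i)"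
proof -
  have "Min ((\<lambda>i. norm (x - d i)) ` {..m}) \<in> (\<lambda>i. norm (x - d i)) ` {..m}" by (intro Min_in) auto
  then obtain j where "j \<le> m" "norm (x - d j) = Min ((\<lambda>i. norm (x - d i)) ` {..m})"
    by (metis (no_types, lifting) atMost_iff imageE)
  then have "\<exists>j. j \<le> m \<and> (\<forall>i\<le>m. norm (x - d j) \<le> norm (x - d i))" by auto
  from LeastI_ex[OF this]
  have "nearest d m x \<le> m \<and> (\<forall>i\<le>m. norm (x - d (nearest d m x)) \<le> norm (x - d i))"
    unfolding nearest_def .
  then show "nearest d m x \<le> m" "i \<le> m \<Longrightarrow> norm (x - d (nearest d m x)) \<le> norm (x - d i)" by auto
qed

text \<open>Ties go to the least index, so the sets on which \<open>nearest d m\<close> is constant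
  are finitely many disjoint measurable cells covering the space.\<close>

lemma measurable_nearest[measurable]:
  fixes d :: "nat \<Rightarrow> 'a::{real_normed_vector, second_countable_topology}"
  shows "nearest d m \<in> borel \<rightarrow>\<^sub>M count_space UNIV"
  unfolding nearest_def[abs_def] by measurable

lemma borel_measurable_quantization_error[measurable]:
  fixes d :: "nat \<Rightarrow> 'a::{real_normed_vector, second_countable_topology}"
  shows "quantization_error d m \<in> borel_measurable borel"
  unfolding quantization_error_def[abs_def] by measurable

lemma (in square_integrable_distribution) quantization_error_tendsto_0:
  fixes d :: "nat \<Rightarrow> 'a"
  assumes dense: "closure (range d) = UNIV"
  shows "(\<lambda>m. \<integral>x. quantization_error d m x \<partial>P) \<longlonglongrightarrow> 0"
    and "\<And>m. integrable P (quantization_error d m)"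
proof -
  have le: "quantization_error d m x \<le> (norm (x - d i))\<^sup>2" if "i \<le> m" for i m x
    unfolding quantization_error_def using norm_nearest_le[OF that] by (intro power_mono) auto
  have nn: "quantization_error d m x \<ge> 0" for m x by (simp add: quantization_error_def)
  have lim: "(\<lambda>m. quantization_error d m x) \<longlonglongrightarrow> 0" for x
  proof (rule tendstoI)
    fix e :: real assume "e > 0"
    have "x \<in> closure (range d)" using dense by simp
    then obtain i where "dist (d i) x < sqrt e" using \<open>e > 0\<close> unfolding closure_approachable
      by (metis (mono_tags, lifting) image_iff real_sqrt_gt_0_iff)
    then have "norm (x - d i) < sqrt e" by (simp add: dist_norm norm_minus_commute)
    then have i: "(norm (x - d i))\<^sup>2 < e"
      by (metis norm_ge_zero power_strict_mono real_sqrt_pow2 \<open>e > 0\<close> less_imp_le pos2)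
    have "quantization_error d m x < e" if "m \<ge> i" for m
      using le[OF that, of x] i by simp
    then show "\<forall>\<^sub>F m in sequentially. dist (quantization_error d m x) 0 < e"
      using nn by (auto simp: eventually_sequentially dist_real_def)
  qed
  have bd: "norm (quantization_error d m x) \<le> (norm (x - d 0))\<^sup>2" for m x
    using le[of 0 m x] nn[of m x] by simp
  have "(\<lambda>m. \<integral>x. quantization_error d m x \<partial>P) \<longlonglongrightarrow> (\<integral>x. 0 \<partial>P)"
    by (rule integral_dominated_convergence[OF _ _ integrable_norm_diff[of "d 0"]]) (use lim bd in auto)
  then show "(\<lambda>m. \<integral>x. quantization_error d m x \<partial>P) \<longlonglongrightarrow> 0" by simp
  show "integrable P (quantization_error d m)" for m
    by (rule Bochner_Integration.integrable_bound[OF integrable_norm_diff[of "d 0"]]) (use bd in auto)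
qed

text \<open>A deterministic statement about one realisation \<open>x\<close>; \<open>freq\<close>
  and \<open>quant\<close> are what holds almost surely. The true risk of \<open>a n\<close> is
  quantised, passed from probabilities to frequencies, unquantised to the empirical risk, compared
  with that of \<open>b\<close> by \<open>min\<close>, and taken back to the true risk of
  \<open>b\<close> in the same way.\<close>

lemma (in square_integrable_distribution) empirical_minimizers_minimize_risk:
  fixes x :: "nat \<Rightarrow> 'a" and a :: "nat \<Rightarrow> nat \<Rightarrow> 'a"
  assumes k: "k \<ge> 1" and dense: "closure (range d) = UNIV"
    and freq: "\<And>m j. (\<lambda>n. (\<Sum>i=1..n. indicator {y. nearest d m y = j} (x i)) / n)
                   \<longlonglongrightarrow> measure P {y. nearest d m y = j}"
    and quant: "\<And>m. \<forall>\<^sub>F n in sequentially. (\<Sum>i=1..n. quantization_error d m (x i))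
                   \<le> 2 * ((\<integral>y. quantization_error d m y \<partial>P) + 1 / Suc m) * n"
    and min: "\<And>n b. n \<ge> 1 \<Longrightarrow> (\<Sum>i=1..n. sqdist k (a n) (x i)) \<le> (\<Sum>i=1..n. sqdist k b (x i))"
    and e: "e > 0"
  shows "\<forall>\<^sub>F n in sequentially. (\<integral>y. sqdist k (a n) y \<partial>P) \<le> (\<integral>y. sqdist k b y \<partial>P) + e"
proof -
  define R where "R c = (\<integral>y. sqdist k c y \<partial>P)" for c
  define A where "A f n = (\<Sum>i=1..n. f (x i)) / n" for f :: "'a \<Rightarrow> real" and n :: nat
  define p where "p m j = measure P {y. nearest d m y = j}" for m j
  define q where "q m j n = A (indicator {y. nearest d m y = j}) n" for m j n
  define \<tau> where "\<tau> m = 2 * ((\<integral>y. quantization_error d m y \<partial>P) + 1 / Suc m)" for m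
  have R0: "R c \<ge> 0" for c unfolding R_def using sqdist_nonneg[OF k] by (intro integral_nonneg_AE) auto
  have E0: "(\<integral>y. quantization_error d m y \<partial>P) \<ge> 0" for m
    by (simp add: quantization_error_def)
  have E\<tau>: "(\<integral>y. quantization_error d m y \<partial>P) \<le> \<tau> m" for m
  proof -
    have "0 \<le> 1 / real (Suc m)" by simp
    then show ?thesis using E0[of m] unfolding \<tau>_def by argo
  qed
  have "\<tau> \<longlonglongrightarrow> 2 * (0 + 0)"
    unfolding \<tau>_def using quantization_error_tendsto_0(1)[OF dense] LIMSEQ_inverse_real_of_nat
    by (intro tendsto_intros) (auto simp: inverse_eq_divide)
  then have \<tau>0: "\<tau> \<longlonglongrightarrow> 0" by simp
  \<comment> \<open>A function of the nearest point is a finite combination of cell indicators, so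
    its integral and its empirical average are the same finite sum with weights \<open>p\<close> and
    \<open>q\<close> respectively.\<close>
  have split: "f (d (nearest d m y)) = (\<Sum>j\<le>m. indicator {y. nearest d m y = j} y * f (d j))"
    for f :: "'a \<Rightarrow> real" and m y
    using nearest_le[of d m y] by (simp add: indicator_def if_distrib[of "\<lambda>t. t * _"] sum.If_cases cong: if_cong)
  have Pq: "(\<integral>y. f (d (nearest d m y)) \<partial>P) = (\<Sum>j\<le>m. p m j * f (d j))" for f :: "'a \<Rightarrow> real" and m
  proof -
    have [measurable]: "{y. nearest d m y = j} \<in> sets P" for j using sets_P by simp
    show ?thesis
      unfolding split p_def
      by (subst Bochner_Integration.integral_sum) (auto simp: space_P less_top[symmetric])
  qed
  have Aq: "A (\<lambda>y. f (d (nearest d m y))) n = (\<Sum>j\<le>m. q m j n * f (d j))" for f :: "'a \<Rightarrow> real" and m n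
    unfolding A_def q_def split
    by (subst sum.swap) (simp add: sum_distrib_right[symmetric] sum_divide_distrib[symmetric])
  have comp: "sqdist k c y \<le> (1 + h) * sqdist k c (d (nearest d m y)) + (1 + 1 / h) * quantization_error d m y"
    and comp': "sqdist k c (d (nearest d m y)) \<le> (1 + h) * sqdist k c y + (1 + 1 / h) * quantization_error d m y"
    if "h > 0" for c m y h
    unfolding quantization_error_def using k that
    by (auto intro!: sqdist_le_perturbed simp: norm_minus_commute)
  have int_q: "integrable P (\<lambda>y. sqdist k c (d (nearest d m y)))" for c m
  proof (rule integrable_const_bound[of _ "\<Sum>j\<le>m. sqdist k c (d j)"])
    show "AE y in P. norm (sqdist k c (d (nearest d m y))) \<le> (\<Sum>j\<le>m. sqdist k c (d j))"
    proof (rule AE_I2)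
      fix y
      have "sqdist k c (d (nearest d m y)) \<le> (\<Sum>j\<le>m. sqdist k c (d j))"
        using nearest_le sqdist_nonneg[OF k] by (intro member_le_sum) auto
      then show "norm (sqdist k c (d (nearest d m y))) \<le> (\<Sum>j\<le>m. sqdist k c (d j))"
        by (simp add: sqdist_nonneg[OF k])
    qed
  qed measurable
  have int_e: "integrable P (quantization_error d m)" for m
    by (rule quantization_error_tendsto_0(2)[OF dense])
  note ints = int_q int_e integrable_sqdist[OF k]
  have R_le: "R c \<le> (1 + h) * (\<Sum>j\<le>m. p m j * sqdist k c (d j)) + (1 + 1 / h) * \<tau> m" if h: "h > 0" for c m h
  proof -
    have "R c \<le> (\<integral>y. (1 + h) * sqdist k c (d (nearest d m y)) + (1 + 1 / h) * quantization_error d m y \<partial>P)"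
      unfolding R_def using ints comp[OF h] by (intro integral_mono) auto
    also have "\<dots> = (1 + h) * (\<Sum>j\<le>m. p m j * sqdist k c (d j)) + (1 + 1 / h) * (\<integral>y. quantization_error d m y \<partial>P)"
      using ints by (subst Bochner_Integration.integral_add) (auto simp: Pq)
    also have "\<dots> \<le> (1 + h) * (\<Sum>j\<le>m. p m j * sqdist k c (d j)) + (1 + 1 / h) * \<tau> m"
      using h E\<tau> by (intro add_left_mono mult_left_mono) auto
    finally show ?thesis .
  qed
  have p_le: "(\<Sum>j\<le>m. p m j * sqdist k c (d j)) \<le> (1 + h) * R c + (1 + 1 / h) * \<tau> m" if h: "h > 0" for c m h
  proof -
    have "(\<Sum>j\<le>m. p m j * sqdist k c (d j)) \<le> (\<integral>y. (1 + h) * sqdist k c y + (1 + 1 / h) * quantization_error d m y \<partial>P)"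
      unfolding Pq[symmetric] using ints comp'[OF h] by (intro integral_mono) auto
    also have "\<dots> = (1 + h) * R c + (1 + 1 / h) * (\<integral>y. quantization_error d m y \<partial>P)"
      using ints by (subst Bochner_Integration.integral_add) (auto simp: R_def)
    also have "\<dots> \<le> (1 + h) * R c + (1 + 1 / h) * \<tau> m"
      using h E\<tau> by (intro add_left_mono mult_left_mono) auto
    finally show ?thesis .
  qed
  have A_mono: "A f n \<le> A g n" if "\<And>y. f y \<le> g y" for f g n
    unfolding A_def using that by (intro divide_right_mono sum_mono) auto
  have A_lin: "A (\<lambda>y. s * f y + t * g y) n = s * A f n + t * A g n" for f g s t n
    unfolding A_def by (simp add: sum.distrib sum_distrib_left[symmetric] add_divide_distrib)
  have A\<tau>: "\<forall>\<^sub>F n in sequentially. A (quantization_error d m) n \<le> \<tau> m" for m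
    using quant[of m] eventually_ge_at_top[of 1]
    by eventually_elim (simp add: A_def \<tau>_def divide_le_eq)
  have q_lim: "(\<lambda>n. q m j n) \<longlonglongrightarrow> p m j" for m j
    unfolding q_def A_def p_def by (rule freq)
  have q0: "q m j n \<ge> 0" for m j n unfolding q_def A_def by (simp add: sum_nonneg)
  \<comment> \<open>Here lies the uniformity in \<open>c\<close>: the weights of nonnegative terms
    are compared cell by cell. Null cells contribute nothing on the left; any other cell eventually
    has frequency above \<open>p m j / (1 + h)\<close>, and these finitely many conditions do not
    mention the centres.\<close>
  have p_q: "\<forall>\<^sub>F n in sequentially. \<forall>c. (\<Sum>j\<le>m. p m j * sqdist k c (d j)) \<le> (1 + h) * (\<Sum>j\<le>m. q m j n * sqdist k c (d j))"
    if h: "h > 0" for m h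
  proof -
    have "\<forall>\<^sub>F n in sequentially. p m j \<le> (1 + h) * q m j n" for j
    proof (cases "p m j = 0")
      case True
      then show ?thesis using q0 h by simp
    next
      case False
      then have "p m j > 0" by (simp add: p_def zero_less_measure_iff)
      then have "p m j < (1 + h) * p m j" using h by (simp add: algebra_simps)
      moreover have "(\<lambda>n. (1 + h) * q m j n) \<longlonglongrightarrow> (1 + h) * p m j" by (intro tendsto_intros q_lim)
      ultimately have "\<forall>\<^sub>F n in sequentially. p m j < (1 + h) * q m j n" by (intro order_tendstoD(1))
      then show ?thesis by eventually_elim simp
    qed
    then have "\<forall>\<^sub>F n in sequentially. \<forall>j\<in>{..m}. p m j \<le> (1 + h) * q m j n"
      by (intro eventually_ball_finite) auto
    then show ?thesis
    proof eventually_elim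
      case (elim n)
      show ?case
        unfolding sum_distrib_left using elim sqdist_nonneg[OF k]
        by (auto intro!: sum_mono mult_right_mono simp: mult.assoc[symmetric])
    qed
  qed
  \<comment> \<open>Of the five factors \<open>1 + h\<close> on \<open>R b\<close>, two quantise and
    unquantise for \<open>b\<close>; the cubed ones belong to \<open>a n\<close>: quantising,
    passing from \<open>p\<close> to \<open>q\<close>, unquantising. The summand \<open>h\<close>
    allows for the convergence of the frequencies at the fixed centres \<open>b\<close>.\<close>
  have main: "\<forall>\<^sub>F n in sequentially. R (a n) \<le> (1 + h) ^ 3 * ((1 + h) * ((1 + h) * R b + (1 + 1 / h) * \<tau> m + h) + (1 + 1 / h) * \<tau> m)
                 + (1 + h) ^ 2 * ((1 + 1 / h) * \<tau> m) + (1 + 1 / h) * \<tau> m"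
    if h: "h > 0" for h m
  proof -
    have "(\<lambda>n. \<Sum>j\<le>m. q m j n * sqdist k b (d j)) \<longlonglongrightarrow> (\<Sum>j\<le>m. p m j * sqdist k b (d j))"
      by (intro tendsto_intros q_lim)
    from order_tendstoD(2)[OF this, of "(\<Sum>j\<le>m. p m j * sqdist k b (d j)) + h"] h
    have "\<forall>\<^sub>F n in sequentially. (\<Sum>j\<le>m. q m j n * sqdist k b (d j)) < (\<Sum>j\<le>m. p m j * sqdist k b (d j)) + h" by simp
    with p_q[OF h, of m] A\<tau>[of m] eventually_ge_at_top[of 1] show ?thesis
    proof eventually_elim
      case (elim n)
      define r where "r = (1 + 1 / h) * \<tau> m"
      have r1: "(1 + 1 / h) * A (quantization_error d m) n \<le> r"
        unfolding r_def using h elim by (intro mult_left_mono) auto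
      have "A (sqdist k b) n \<le> A (\<lambda>y. (1 + h) * sqdist k b (d (nearest d m y)) + (1 + 1 / h) * quantization_error d m y) n"
        by (rule A_mono) (rule comp[OF h])
      also have "\<dots> \<le> (1 + h) * ((\<Sum>j\<le>m. p m j * sqdist k b (d j)) + h) + r"
        unfolding A_lin Aq using r1 elim h by (intro add_mono mult_left_mono) auto
      also have "\<dots> \<le> (1 + h) * ((1 + h) * R b + r + h) + r"
        using p_le[OF h, of m b] h unfolding r_def[symmetric] by (intro add_mono mult_left_mono) auto
      finally have b: "A (sqdist k b) n \<le> (1 + h) * ((1 + h) * R b + r + h) + r" .
      have ab: "A (sqdist k (a n)) n \<le> A (sqdist k b) n"
        unfolding A_def using min[of n b] elim by (intro divide_right_mono) auto
      have "R (a n) \<le> (1 + h) * (\<Sum>j\<le>m. p m j * sqdist k (a n) (d j)) + r"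
        using R_le[OF h] by (simp add: r_def)
      also have "\<dots> \<le> (1 + h) * ((1 + h) * A (\<lambda>y. sqdist k (a n) (d (nearest d m y))) n) + r"
        unfolding Aq using elim h by (intro add_mono mult_left_mono) auto
      also have "\<dots> \<le> (1 + h) * ((1 + h) * A (\<lambda>y. (1 + h) * sqdist k (a n) y + (1 + 1 / h) * quantization_error d m y) n) + r"
        using h by (intro add_mono mult_left_mono A_mono comp') auto
      also have "\<dots> \<le> (1 + h) * ((1 + h) * ((1 + h) * ((1 + h) * ((1 + h) * R b + r + h) + r) + r)) + r"
        unfolding A_lin using h r1 ab b by (intro add_mono mult_left_mono) auto
      also have "\<dots> = (1 + h) ^ 3 * ((1 + h) * ((1 + h) * R b + r + h) + r) + (1 + h) ^ 2 * r + r"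
        by (simp add: power3_eq_cube power2_eq_square algebra_simps)
      finally show ?case unfolding r_def .
    qed
  qed
  \<comment> \<open>The order of choice matters: \<open>1 + 1 / h\<close> is unbounded as
    \<open>h\<close> tends to 0, so \<open>h\<close> is fixed first with the terms in
    \<open>\<tau> m\<close> left out, and \<open>m\<close> is then taken large for that
    \<open>h\<close>.\<close>
  have "((\<lambda>h. (1 + h) ^ 3 * ((1 + h) * ((1 + h) * R b + h))) \<longlongrightarrow> (1 + 0) ^ 3 * ((1 + 0) * ((1 + 0) * R b + 0))) (at_right 0)"
    by (intro tendsto_intros)
  then have "\<forall>\<^sub>F h in at_right 0. (1 + h) ^ 3 * ((1 + h) * ((1 + h) * R b + h)) < R b + e / 2"
    by (rule order_tendstoD) (use e in simp)
  moreover have "\<forall>\<^sub>F h::real in at_right 0. h > 0" by (rule eventually_at_right_less)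
  ultimately have "\<forall>\<^sub>F h in at_right 0. h > 0 \<and> (1 + h) ^ 3 * ((1 + h) * ((1 + h) * R b + h)) < R b + e / 2"
    by eventually_elim simp
  then obtain h where h: "h > 0" "(1 + h) ^ 3 * ((1 + h) * ((1 + h) * R b + h)) < R b + e / 2"
    using eventually_happens[of _ "at_right (0::real)"] by auto
  have "(\<lambda>m. (1 + h) ^ 3 * ((1 + h) * ((1 + h) * R b + (1 + 1 / h) * \<tau> m + h) + (1 + 1 / h) * \<tau> m)
                 + (1 + h) ^ 2 * ((1 + 1 / h) * \<tau> m) + (1 + 1 / h) * \<tau> m) \<longlonglongrightarrow>
        (1 + h) ^ 3 * ((1 + h) * ((1 + h) * R b + (1 + 1 / h) * 0 + h) + (1 + 1 / h) * 0)
                 + (1 + h) ^ 2 * ((1 + 1 / h) * 0) + (1 + 1 / h) * 0" (is "?F \<longlonglongrightarrow> ?l")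
    by (intro tendsto_intros \<tau>0)
  moreover have "?l < R b + e" using h(2) e by simp
  ultimately have "\<forall>\<^sub>F m in sequentially. ?F m < R b + e" by (rule order_tendstoD)
  then obtain m where m: "?F m < R b + e" by (auto simp: eventually_sequentially)
  from main[OF h(1), of m] show ?thesis
    unfolding R_def[symmetric] by eventually_elim (use m in linarith)
qed

text \<open>The quantifier over \<open>a\<close> stands inside \<open>AE\<close>: the null set
  depends on the countably many pairs \<open>m\<close>, \<open>j\<close> only, so the centres may
  afterwards depend on the sample in any way.\<close>

lemma (in prob_space) AE_empirical_minimizers_minimize_risk:
  fixes Xs :: "nat \<Rightarrow> 'a \<Rightarrow> 'b::{banach, second_countable_topology}"
  assumes P: "square_integrable_distribution P" and k: "k \<ge> 1"
    and indep: "indep_vars (\<lambda>_. borel) Xs {1..}"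
    and distr: "\<And>i. i \<ge> 1 \<Longrightarrow> distr M borel (Xs i) = P"
  shows "AE \<omega> in M. \<forall>a. (\<forall>n\<ge>1. \<forall>b. (\<Sum>i=1..n. sqdist k (a n) (Xs i \<omega>)) \<le> (\<Sum>i=1..n. sqdist k b (Xs i \<omega>)))
           \<longrightarrow> (\<forall>b. \<forall>e>0. \<forall>\<^sub>F n in sequentially. (\<integral>y. sqdist k (a n) y \<partial>P) \<le> (\<integral>y. sqdist k b y \<partial>P) + e)"
proof -
  interpret P: square_integrable_distribution P by fact
  have rv: "Xs i \<in> borel_measurable M" if "i \<ge> 1" for i
    using indep that by (auto simp: indep_vars_def)
  obtain D :: "'b set" where D: "countable D" "\<And>U. open U \<Longrightarrow> U \<noteq> {} \<Longrightarrow> \<exists>d\<in>D. d \<in> U"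
    using countable_dense_setE by metis
  have "D \<noteq> {}" using D(2)[of UNIV] by auto
  define d where "d = from_nat_into D"
  have rd: "range d = D" unfolding d_def using D(1) \<open>D \<noteq> {}\<close> by (simp add: range_from_nat_into)
  have dense: "closure (range d) = UNIV"
  proof -
    have "x \<in> closure D" for x
      unfolding closure_approachable
    proof (intro allI impI)
      fix e :: real assume "e > 0"
      then show "\<exists>y\<in>D. dist y x < e" using D(2)[of "ball x e"] by (auto simp: dist_commute)
    qed
    then show ?thesis using rd by auto
  qed
  have freq: "AE \<omega> in M. \<forall>m j. (\<lambda>n. (\<Sum>i=1..n. indicator {y. nearest d m y = j} (Xs i \<omega>)) / n)
                   \<longlonglongrightarrow> measure P {y. nearest d m y = j}"
    unfolding AE_all_countable
    by (intro allI iid_relative_frequency_tendsto[OF indep distr]) auto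
  have quant: "AE \<omega> in M. \<forall>\<^sub>F n in sequentially. (\<Sum>i=1..n. quantization_error d m (Xs i \<omega>))
                   \<le> 2 * ((\<integral>y. quantization_error d m y \<partial>P) + 1 / Suc m) * n" for m
  proof -
    define Y where "Y i \<omega> = quantization_error d m (Xs i \<omega>)" for i \<omega>
    have 1: "indep_vars (\<lambda>_. borel) Y {1..}"
      unfolding Y_def by (rule indep_vars_compose2[OF indep]) auto
    have Yd: "distr M borel (Y i) = distr P borel (quantization_error d m)" if "i \<ge> 1" for i
      using distr_distr[OF borel_measurable_quantization_error rv[OF that], of d m] distr[OF that]
      by (simp add: Y_def[abs_def] comp_def)
    have EY: "expectation (Y 1) = (\<integral>y. quantization_error d m y \<partial>P)"
      using integral_distr[OF rv[of 1] borel_measurable_quantization_error[of d m]] distr[of 1]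
      by (simp add: Y_def[abs_def])
    have iY: "integrable M (Y 1)"
      using integrable_distr_eq[OF rv[of 1] borel_measurable_quantization_error[of d m]] distr[of 1]
        P.quantization_error_tendsto_0(2)[OF dense, of m]
      by (simp add: Y_def[abs_def])
    have "AE \<omega> in M. \<forall>\<^sub>F n in sequentially. (\<Sum>i=1..n. Y i \<omega>) \<le> 2 * (expectation (Y 1) + 1 / Suc m) * n"
    proof (rule iid_average_le_twice_mean[OF 1 _ _ iY])
      show "distr M borel (Y i) = distr M borel (Y 1)" if "i \<ge> 1" for i
        using Yd[OF that] Yd[of 1] by simp
    qed (auto simp: Y_def quantization_error_def)
    then show ?thesis unfolding EY by (simp add: Y_def)
  qed
  have "AE \<omega> in M. \<forall>m. \<forall>\<^sub>F n in sequentially. (\<Sum>i=1..n. quantization_error d m (Xs i \<omega>))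
                   \<le> 2 * ((\<integral>y. quantization_error d m y \<partial>P) + 1 / Suc m) * n"
    unfolding AE_all_countable using quant by blast
  with freq show ?thesis
  proof eventually_elim
    case (elim \<omega>)
    show ?case
      using elim
      by (intro allI impI P.empirical_minimizers_minimize_risk[OF k dense, of "\<lambda>i. Xs i \<omega>"]) blast+
  qed
qed

subsection \<open>Compactness of minimising sequences\<close>

text \<open>Cantor's diagonal argument. At coordinate \<open>m\<close> only the diagonal beyond
  \<open>m\<close> is a subsequence of the one chosen there, which is enough for
  convergence.\<close>

lemma pointwise_bounded_imp_convergent_subsequence:
  fixes f :: "nat \<Rightarrow> nat \<Rightarrow> real"
  assumes bdd: "\<And>m. \<exists>C. \<forall>n. \<bar>f n m\<bar> \<le> C"
  obtains r where "strict_mono r" "\<And>m. convergent (\<lambda>n. f (r n) m)"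
proof -
  let ?P = "\<lambda>m s. convergent (\<lambda>n. f (s n) m)"
  interpret nat: subseqs ?P
  proof
    fix m and s :: "nat \<Rightarrow> nat" assume "strict_mono s"
    obtain C where "\<And>n. \<bar>f n m\<bar> \<le> C" using bdd by blast
    then have "\<And>n. f (s n) m \<in> {-C..C}" by (simp add: abs_le_iff minus_le_iff)
    then obtain l s' where "strict_mono s'" "((\<lambda>n. f (s n) m) \<circ> s') \<longlonglongrightarrow> l"
      using compact_Icc compact_imp_seq_compact seq_compactE by metis
    then show "\<exists>s'. strict_mono s' \<and> convergent (\<lambda>n. f ((s \<circ> s') n) m)"
      by (auto simp: comp_def convergent_def)
  qed
  have "?P m (nat.diagseq \<circ> (+) (Suc m))" for m
    by (rule nat.diagseq_holds) (auto simp: comp_def intro: convergent_subseq_convergent[unfolded comp_def])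
  then have "convergent (\<lambda>n. f (nat.diagseq n) m)" for m
    using convergent_ignore_initial_segment[of "\<lambda>n. f (nat.diagseq n) m" "Suc m"]
    by (simp add: comp_def add.commute[of _ "m"])
  with nat.subseq_diagseq that show ?thesis by blast
qed

text \<open>For \<open>c > 0\<close> the unit vectors \<open>sgn (u n)\<close> and
  \<open>sgn (v n)\<close> are asymptotically \<open>u n\<close> and \<open>v n\<close> divided by
  \<open>c\<close>, so their midpoints have norms tending to 1. Uniform convexity then forbids them
  to stay apart.\<close>

lemma uniformly_convex_midpoint_sequences:
  fixes u v :: "nat \<Rightarrow> 'a::real_normed_vector"
  assumes uc: "uniformly_convex TYPE('a)"
    and u: "(\<lambda>n. norm (u n)) \<longlonglongrightarrow> c" and v: "(\<lambda>n. norm (v n)) \<longlonglongrightarrow> c"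
    and uv: "(\<lambda>n. norm ((1/2) *\<^sub>R (u n + v n))) \<longlonglongrightarrow> c"
  shows "(\<lambda>n. u n - v n) \<longlonglongrightarrow> 0"
proof (cases "c = 0")
  case True
  then show ?thesis using u v tendsto_diff[of u 0 _ v 0] by (simp add: tendsto_norm_zero_iff)
next
  case False
  moreover have "c \<ge> 0" by (rule LIMSEQ_le_const[OF u]) auto
  ultimately have c: "c > 0" by simp
  have sgn: "(\<lambda>n. sgn (w n) - (1/c) *\<^sub>R w n) \<longlonglongrightarrow> 0" and nz: "\<forall>\<^sub>F n in sequentially. w n \<noteq> 0"
    if w: "(\<lambda>n. norm (w n)) \<longlonglongrightarrow> c" for w :: "nat \<Rightarrow> 'a"
  proof -
    show nz: "\<forall>\<^sub>F n in sequentially. w n \<noteq> 0"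
      using order_tendstoD(1)[OF w c] by eventually_elim auto
    have "(\<lambda>n. \<bar>1 - norm (w n) / c\<bar>) \<longlonglongrightarrow> \<bar>1 - c / c\<bar>" by (intro tendsto_intros w) (use c in auto)
    then have "(\<lambda>n. \<bar>1 - norm (w n) / c\<bar>) \<longlonglongrightarrow> 0" using c by simp
    moreover have "\<forall>\<^sub>F n in sequentially. \<bar>1 - norm (w n) / c\<bar> = norm (sgn (w n) - (1/c) *\<^sub>R w n)"
      using nz
    proof eventually_elim
      case (elim n)
      have "sgn (w n) - (1/c) *\<^sub>R w n = (1 / norm (w n) - 1/c) *\<^sub>R w n"
        by (simp add: sgn_div_norm scaleR_diff_left divide_inverse)
      then have "norm (sgn (w n) - (1/c) *\<^sub>R w n) = \<bar>(1 / norm (w n) - 1/c) * norm (w n)\<bar>"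
        by (simp add: abs_mult)
      also have "(1 / norm (w n) - 1/c) * norm (w n) = 1 - norm (w n) / c"
        using elim by (simp add: left_diff_distrib)
      finally show ?case by simp
    qed
    ultimately have "(\<lambda>n. norm (sgn (w n) - (1/c) *\<^sub>R w n)) \<longlonglongrightarrow> 0"
      by (rule Lim_transform_eventually)
    then show "(\<lambda>n. sgn (w n) - (1/c) *\<^sub>R w n) \<longlonglongrightarrow> 0" by (rule tendsto_norm_zero_cancel)
  qed
  have mid: "(\<lambda>n. norm ((1/2) *\<^sub>R (sgn (u n) + sgn (v n)))) \<longlonglongrightarrow> 1"
  proof -
    have "(\<lambda>n. (1/2) *\<^sub>R ((sgn (u n) - (1/c) *\<^sub>R u n) + (sgn (v n) - (1/c) *\<^sub>R v n))) \<longlonglongrightarrow> (1/2) *\<^sub>R (0 + 0)"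
      by (intro tendsto_intros sgn u v)
    then have 1: "(\<lambda>n. (1/2) *\<^sub>R (sgn (u n) + sgn (v n)) - (1/c) *\<^sub>R ((1/2) *\<^sub>R (u n + v n))) \<longlonglongrightarrow> 0"
      by (simp add: algebra_simps)
    have 2: "(\<lambda>n. norm ((1/c) *\<^sub>R ((1/2) *\<^sub>R (u n + v n)))) \<longlonglongrightarrow> 1"
      using tendsto_mult[OF tendsto_const[of "1/c"] uv] c by simp
    show ?thesis
    proof (rule Lim_transform[OF 2])
      show "(\<lambda>n. norm ((1/2) *\<^sub>R (sgn (u n) + sgn (v n))) - norm ((1/c) *\<^sub>R ((1/2) *\<^sub>R (u n + v n)))) \<longlonglongrightarrow> 0"
        by (rule tendsto_norm_zero_cancel, rule tendsto_sandwich[OF _ _ tendsto_const tendsto_norm_zero[OF 1]])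
           (auto intro!: always_eventually norm_triangle_ineq3 simp del: norm_scaleR)
    qed
  qed
  have "(\<lambda>n. sgn (u n) - sgn (v n)) \<longlonglongrightarrow> 0"
  proof (rule tendstoI)
    fix e :: real assume "e > 0"
    with uc obtain \<delta> where \<delta>: "\<delta> > 0"
      "\<And>x y::'a. norm x = 1 \<Longrightarrow> norm y = 1 \<Longrightarrow> norm (x - y) \<ge> e \<Longrightarrow> norm ((1/2) *\<^sub>R (x + y)) \<le> 1 - \<delta>"
      unfolding uniformly_convex_def by blast
    have "\<forall>\<^sub>F n in sequentially. norm ((1/2) *\<^sub>R (sgn (u n) + sgn (v n))) > 1 - \<delta>"
      using \<delta>(1) by (intro order_tendstoD(1)[OF mid]) simp
    with nz[OF u] nz[OF v] show "\<forall>\<^sub>F n in sequentially. dist (sgn (u n) - sgn (v n)) 0 < e"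
    proof eventually_elim
      case (elim n)
      have "norm (sgn (u n)) = 1" "norm (sgn (v n)) = 1" using elim by (auto simp: norm_sgn)
      with \<delta>(2)[of "sgn (u n)" "sgn (v n)"] elim(3) show ?case by fastforce
    qed
  qed
  then have "(\<lambda>n. c *\<^sub>R ((sgn (u n) - sgn (v n)) - (sgn (u n) - (1/c) *\<^sub>R u n) + (sgn (v n) - (1/c) *\<^sub>R v n))) \<longlonglongrightarrow> c *\<^sub>R (0 - 0 + 0)"
    by (intro tendsto_intros sgn u v)
  then show ?thesis using c by (simp add: algebra_simps)
qed

lemma (in square_integrable_distribution) integrable_norm_diff_selection:
  assumes [measurable]: "\<iota> \<in> borel \<rightarrow>\<^sub>M count_space UNIV" and "\<And>x. \<iota> x \<in> {1..k::nat}"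
  shows "integrable P (\<lambda>x. (norm (x - b (\<iota> x)))\<^sup>2)"
proof (rule Bochner_Integration.integrable_bound)
  show "integrable P (\<lambda>x. \<Sum>i\<in>{1..k}. (norm (x - b i))\<^sup>2)"
    by (intro Bochner_Integration.integrable_sum integrable_norm_diff)
  have "(norm (x - b (\<iota> x)))\<^sup>2 \<le> (\<Sum>i\<in>{1..k}. (norm (x - b i))\<^sup>2)" for x
    using assms(2) by (intro member_le_sum) auto
  then show "AE x in P. norm ((norm (x - b (\<iota> x)))\<^sup>2) \<le> norm (\<Sum>i\<in>{1..k}. (norm (x - b i))\<^sup>2)"
    by (auto simp: sum_nonneg)
qed measurable

text \<open>If all centres lie outside the ball of radius \<open>B\<close>, serving \<open>x\<close>
  costs at least B^2 / 2 - |x|^2, so a large \<open>B\<close> is more expensive than a single centre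
  at the origin.\<close>

lemma (in square_integrable_distribution) some_center_bounded:
  assumes k: "k \<ge> 1"
    and min: "\<And>b e. e > 0 \<Longrightarrow> \<forall>\<^sub>F n in sequentially. (\<integral>x. sqdist k (a n) x \<partial>P) \<le> (\<integral>x. sqdist k b x \<partial>P) + e"
  obtains B where "B > 0" "\<forall>\<^sub>F n in sequentially. \<exists>i\<in>{1..k}. norm (a n i) \<le> B"
proof -
  define S where "S = (\<integral>x. (norm x)\<^sup>2 \<partial>P)"
  have S0: "S \<ge> 0" by (simp add: S_def)
  \<comment> \<open>Chosen so that B^2 / 2 - S = S + 2 exceeds the bound S + 1 that the risks
    eventually obey.\<close>
  define B where "B = sqrt (4 * S + 4)"
  have B: "B > 0" "B\<^sup>2 = 4 * S + 4" using S0 by (auto simp: B_def)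
  have "(\<integral>x. sqdist k (\<lambda>_. 0) x \<partial>P) = S"
    using k by (simp add: sqdist_def S_def image_constant_conv)
  with min[of 1 "\<lambda>_. 0"] have "\<forall>\<^sub>F n in sequentially. (\<integral>x. sqdist k (a n) x \<partial>P) \<le> S + 1" by simp
  then have "\<forall>\<^sub>F n in sequentially. \<exists>i\<in>{1..k}. norm (a n i) \<le> B"
  proof eventually_elim
    case (elim n)
    show ?case
    proof (rule ccontr)
      assume "\<not> (\<exists>i\<in>{1..k}. norm (a n i) \<le> B)"
      then have far: "norm (a n i) > B" if "i \<in> {1..k}" for i using that by force
      have "B\<^sup>2 / 2 - (norm x)\<^sup>2 \<le> sqdist k (a n) x" for x
      proof -
        obtain i where i: "i \<in> {1..k}" "sqdist k (a n) x = (norm (x - a n i))\<^sup>2"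
          using sqdist_attained[OF k] .
        have "B\<^sup>2 \<le> (norm (a n i))\<^sup>2" using far[OF i(1)] B by (intro power_mono) auto
        also have "\<dots> = (norm (x + (a n i - x)))\<^sup>2" by simp
        also have "\<dots> \<le> 2 * (norm x)\<^sup>2 + 2 * (norm (a n i - x))\<^sup>2"
          using norm_add_squared_le[of 1 x "a n i - x"] by simp
        finally show ?thesis using i(2) by (simp add: norm_minus_commute)
      qed
      then have "(\<integral>x. B\<^sup>2 / 2 - (norm x)\<^sup>2 \<partial>P) \<le> (\<integral>x. sqdist k (a n) x \<partial>P)"
        using integrable_sqdist[OF k] moment by (intro integral_mono) auto
      also have "(\<integral>x. B\<^sup>2 / 2 - (norm x)\<^sup>2 \<partial>P) = B\<^sup>2 / 2 - S"
        using moment by (subst Bochner_Integration.integral_diff) (auto simp: S_def prob_space)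
      finally show False using elim B by linarith
    qed
  qed
  with B(1) that show ?thesis by blast
qed


text \<open>
  Distances to the centres converge along a subsequence; centres that escape are hidden by
  truncation at \<open>\<parallel>x\<parallel> + B + 1\<close>. Assigning to each point the centre that is nearest in the limit, the
  risk of the midpoints of two members of the subsequence is not below the infimum, and uniform
  convexity then forces the centres that serve a set of positive measure to be Cauchy.
\<close>

lemma (in square_integrable_distribution) minimizing_sequence_subsequence:
  fixes a :: "nat \<Rightarrow> nat \<Rightarrow> 'a"
  assumes uc: "uniformly_convex TYPE('a)"
    and k: "k \<ge> 1"
    and min: "\<And>b e. e > 0 \<Longrightarrow> \<forall>\<^sub>F n in sequentially. (\<integral>x. sqdist k (a n) x \<partial>P) \<le> (\<integral>x. sqdist k b x \<partial>P) + e"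
  obtains r J l where "strict_mono r" "J \<subseteq> {1..k}" "J \<noteq> {}"
    "\<And>i. i \<in> J \<Longrightarrow> (\<lambda>n. a (r n) i) \<longlonglongrightarrow> l i"
    "\<And>b c. l ` J \<subseteq> b ` {1..k} \<Longrightarrow> (\<integral>x. sqdist k b x \<partial>P) \<le> (\<integral>x. sqdist k c x \<partial>P)"
proof -
  obtain B where B: "B > 0" and near: "\<forall>\<^sub>F n in sequentially. \<exists>i\<in>{1..k}. norm (a n i) \<le> B"
    using some_center_bounded[OF k min] by blast
  \<comment> \<open>Some centre is always within \<open>norm x + B\<close> of \<open>x\<close>. The
    extra 1 leaves a gap, so the truncation is eventually inactive for the centre that is nearest in
    the limit.\<close>
  define c where "c n i x = min (norm (x - a n i)) (norm x + B + 1)" for n i x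
  have c_bd: "\<bar>c n i x\<bar> \<le> norm x + B + 1" for n i x
    using B by (auto simp: c_def min_def)
  have c_lip: "\<bar>c n i x - c n i y\<bar> \<le> norm (x - y)" for n i x y
  proof -
    have "\<bar>norm (x - a n i) - norm (y - a n i)\<bar> \<le> norm (x - y)"
      using norm_triangle_ineq3[of "x - a n i" "y - a n i"] by simp
    moreover have "\<bar>norm x - norm y\<bar> \<le> norm (x - y)" by (rule norm_triangle_ineq3)
    ultimately show ?thesis unfolding c_def min_def by (auto simp: abs_le_iff)
  qed
  obtain D :: "'a set" where D: "countable D" "\<And>U. open U \<Longrightarrow> U \<noteq> {} \<Longrightarrow> \<exists>d\<in>D. d \<in> U"
    using countable_dense_setE by metis
  have "D \<noteq> {}" using D(2)[of UNIV] by auto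
  define f where "f n m = c n (fst (prod_decode m)) (from_nat_into D (snd (prod_decode m)))" for n m
  obtain r where r: "strict_mono r" and fr: "\<And>m. convergent (\<lambda>n. f (r n) m)"
    using pointwise_bounded_imp_convergent_subsequence[of f] c_bd unfolding f_def by metis
  have conv_D: "convergent (\<lambda>n. c (r n) i d)" if d: "d \<in> D" for i d
  proof -
    obtain j where "d = from_nat_into D j"
      using from_nat_into_surj[OF D(1) d] by metis
    then show ?thesis using fr[of "prod_encode (i, j)"] by (simp add: f_def)
  qed
  \<comment> \<open>The functions \<open>c n i\<close> are 1-Lipschitz with a constant independent
    of \<open>n\<close>, so convergence on the dense set \<open>D\<close> spreads to every
    point.\<close>
  have conv: "convergent (\<lambda>n. c (r n) i x)" for i x
  proof -
    have "Cauchy (\<lambda>n. c (r n) i x)"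
    proof (rule CauchyI)
      fix e :: real assume e: "e > 0"
      then obtain d where d: "d \<in> D" "norm (x - d) < e / 3"
        using D(2)[of "ball x (e / 3)"] by (auto simp: dist_norm)
      from conv_D[OF d(1)] have "Cauchy (\<lambda>n. c (r n) i d)" by (simp add: convergent_eq_Cauchy convergent_def)
      then obtain N where N: "\<And>m n. m \<ge> N \<Longrightarrow> n \<ge> N \<Longrightarrow> norm (c (r m) i d - c (r n) i d) < e / 3"
        using e CauchyD[of _ "e / 3"] by (metis zero_less_divide_iff zero_less_numeral)
      have "norm (c (r m) i x - c (r n) i x) < e" if "m \<ge> N" "n \<ge> N" for m n
        using N[OF that] c_lip[of "r m" i x d] c_lip[of "r n" i x d] d(2)
        unfolding real_norm_def by linarith
      then show "\<exists>N. \<forall>m\<ge>N. \<forall>n\<ge>N. norm (c (r m) i x - c (r n) i x) < e" by blast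
    qed
    then show ?thesis by (simp add: Cauchy_convergent)
  qed
  define \<gamma> where "\<gamma> i x = lim (\<lambda>n. c (r n) i x)" for i x
  have \<gamma>: "(\<lambda>n. c (r n) i x) \<longlonglongrightarrow> \<gamma> i x" for i x
    unfolding \<gamma>_def using conv by (simp add: convergent_LIMSEQ_iff)
  have [measurable]: "\<gamma> i \<in> borel_measurable borel" for i
    by (rule borel_measurable_LIMSEQ_metric[OF _ \<gamma>]) (simp add: c_def)
  \<comment> \<open>The centre that serves \<open>x\<close> in the limit; taking the least such
    index makes the choice measurable.\<close>
  define \<iota> where "\<iota> x = (LEAST i. i \<in> {1..k} \<and> (\<forall>j\<in>{1..k}. \<gamma> i x \<le> \<gamma> j x))" for x
  have \<iota>: "\<iota> x \<in> {1..k} \<and> (\<forall>j\<in>{1..k}. \<gamma> (\<iota> x) x \<le> \<gamma> j x)" for x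
  proof -
    have "Min ((\<lambda>i. \<gamma> i x) ` {1..k}) \<in> (\<lambda>i. \<gamma> i x) ` {1..k}" using k by (intro Min_in) auto
    then obtain i where "i \<in> {1..k}" "\<gamma> i x = Min ((\<lambda>i. \<gamma> i x) ` {1..k})"
      by (metis (no_types, lifting) imageE)
    then have "\<exists>i. i \<in> {1..k} \<and> (\<forall>j\<in>{1..k}. \<gamma> i x \<le> \<gamma> j x)" by auto
    then show ?thesis unfolding \<iota>_def by (rule LeastI_ex)
  qed
  have \<iota>_mem: "\<iota> x \<in> {1..k}" for x using \<iota> by blast
  have [measurable]: "\<iota> \<in> borel \<rightarrow>\<^sub>M count_space UNIV"
    unfolding \<iota>_def[abs_def] by measurable
  have \<gamma>_le: "\<gamma> (\<iota> x) x \<le> norm x + B" for x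
  proof (rule ccontr)
    assume "\<not> ?thesis"
    then have "norm x + B < \<gamma> i x" if "i \<in> {1..k}" for i using \<iota>[of x] that by force
    then have "\<forall>\<^sub>F n in sequentially. \<forall>i\<in>{1..k}. norm x + B < c (r n) i x"
      by (intro eventually_ball_finite ballI order_tendstoD(1)[OF \<gamma>]) auto
    moreover have "\<forall>\<^sub>F n in sequentially. \<exists>i\<in>{1..k}. norm (a (r n) i) \<le> B"
      using near r by (rule eventually_subseq[rotated])
    ultimately have "\<forall>\<^sub>F n in sequentially. False"
    proof eventually_elim
      case (elim n)
      then obtain i where i: "i \<in> {1..k}" "norm (a (r n) i) \<le> B" by blast
      have "c (r n) i x \<le> norm (x - a (r n) i)" by (simp add: c_def)
      also have "\<dots> \<le> norm x + B" using norm_triangle_ineq4[of x "a (r n) i"] i by linarith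
      finally show ?case using elim i by force
    qed
    then show False by simp
  qed
  have near_lim: "(\<lambda>n. norm (x - a (r n) (\<iota> x))) \<longlonglongrightarrow> \<gamma> (\<iota> x) x" for x
  proof (rule Lim_transform_eventually[OF \<gamma>])
    have "\<forall>\<^sub>F n in sequentially. c (r n) (\<iota> x) x < norm x + B + 1"
      using \<gamma>_le[of x] by (intro order_tendstoD(2)[OF \<gamma>]) simp
    then show "\<forall>\<^sub>F n in sequentially. c (r n) (\<iota> x) x = norm (x - a (r n) (\<iota> x))"
      by eventually_elim (auto simp: c_def)
  qed
  have \<gamma>0: "\<gamma> (\<iota> x) x \<ge> 0" for x by (rule LIMSEQ_le_const[OF near_lim]) auto
  have sqdist_lim: "(\<lambda>n. sqdist k (a (r n)) x) \<longlonglongrightarrow> (\<gamma> (\<iota> x) x)\<^sup>2" for x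
  proof (rule order_tendstoI)
    fix s assume s: "(\<gamma> (\<iota> x) x)\<^sup>2 < s"
    have "\<forall>\<^sub>F n in sequentially. (norm (x - a (r n) (\<iota> x)))\<^sup>2 < s"
      by (rule order_tendstoD(2)[OF tendsto_power[OF near_lim] s])
    then show "\<forall>\<^sub>F n in sequentially. sqdist k (a (r n)) x < s"
      by eventually_elim (rule le_less_trans[OF sqdist_le[OF \<iota>_mem]])
  next
    fix s assume s: "s < (\<gamma> (\<iota> x) x)\<^sup>2"
    show "\<forall>\<^sub>F n in sequentially. s < sqdist k (a (r n)) x"
    proof (cases "s < 0")
      case True
      then show ?thesis using sqdist_nonneg[OF k] by (auto intro!: always_eventually less_le_trans[OF True])
    next
      case False
      then have "sqrt s < \<gamma> (\<iota> x) x" using s \<gamma>0[of x] real_less_lsqrt by simp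
      then have "sqrt s < \<gamma> i x" if "i \<in> {1..k}" for i using \<iota>[of x] that by force
      then have "\<forall>\<^sub>F n in sequentially. \<forall>i\<in>{1..k}. sqrt s < c (r n) i x"
        by (intro eventually_ball_finite ballI order_tendstoD(1)[OF \<gamma>]) auto
      then show ?thesis
      proof eventually_elim
        case (elim n)
        obtain i where i: "i \<in> {1..k}" "sqdist k (a (r n)) x = (norm (x - a (r n) i))\<^sup>2"
          using sqdist_attained[OF k] .
        have "sqrt s < norm (x - a (r n) i)" using elim i by (force simp: c_def)
        then show ?case unfolding i(2) using real_sqrt_less_iff[of s "(norm (x - a (r n) i))\<^sup>2"] by simp
      qed
    qed
  qed
  \<comment> \<open>An index in the range of \<open>\<iota>\<close> serves some point, to which the
    distances of its centres converge; hence these centres stay bounded. This gives the integrable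
    majorant \<open>w\<close>.\<close>
  have "\<exists>C. \<forall>i\<in>range \<iota>. \<forall>n. norm (a (r n) i) \<le> C"
  proof -
    have "\<exists>C. \<forall>n. norm (a (r n) i) \<le> C" if i: "i \<in> range \<iota>" for i
    proof -
      from i obtain x where x: "i = \<iota> x" by blast
      from near_lim[of x] have "Bseq (\<lambda>n. norm (x - a (r n) i))"
        unfolding x[symmetric] by (intro convergent_imp_Bseq convergentI)
      then obtain C where C: "\<And>n. norm (x - a (r n) i) \<le> C" by (auto simp: Bseq_def)
      have "norm (a (r n) i) \<le> norm x + C" for n
        using C[of n] norm_triangle_ineq4[of x "x - a (r n) i"] by simp
      then show ?thesis by blast
    qed
    then obtain C where C: "\<And>i n. i \<in> range \<iota> \<Longrightarrow> norm (a (r n) i) \<le> C i" by metis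
    have fin: "finite (range \<iota>)" by (rule finite_subset[of _ "{1..k}"]) (use \<iota>_mem in auto)
    have "norm (a (r n) i) \<le> Max (C ` range \<iota>)" if "i \<in> range \<iota>" for i n
      using C[OF that, of n] Max_ge[of "C ` range \<iota>" "C i"] fin that by (auto intro: order_trans)
    then show ?thesis by blast
  qed
  then obtain C where C: "\<And>x n. norm (a (r n) (\<iota> x)) \<le> C" by blast
  define w where "w x = 2 * (norm x)\<^sup>2 + 2 * C\<^sup>2" for x :: 'a
  have w: "integrable P w" unfolding w_def using moment by auto
  have le_w: "(norm (x - a (r n) (\<iota> x)))\<^sup>2 \<le> w x" for n x
  proof -
    have "(norm (x - a (r n) (\<iota> x)))\<^sup>2 \<le> 2 * (norm x)\<^sup>2 + 2 * (norm (a (r n) (\<iota> x)))\<^sup>2"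
      using norm_add_squared_le[of 1 x "- a (r n) (\<iota> x)"] by simp
    moreover have "(norm (a (r n) (\<iota> x)))\<^sup>2 \<le> C\<^sup>2" using C by (intro power_mono) auto
    ultimately show ?thesis by (simp add: w_def)
  qed
  \<comment> \<open>\<open>\<Phi>\<close> is the cost when every point keeps its assignment
    \<open>\<iota>\<close>. It dominates the risk and has the same limit \<open>G\<close> along the
    subsequence, but unlike the risk, a minimum over centres, it is convex in \<open>b\<close>, so
    midpoints can be used.\<close>
  define \<Phi> where "\<Phi> b = (\<integral>x. (norm (x - b (\<iota> x)))\<^sup>2 \<partial>P)" for b :: "nat \<Rightarrow> 'a"
  define R where "R b = (\<integral>x. sqdist k b x \<partial>P)" for b :: "nat \<Rightarrow> 'a"
  define G where "G = (\<integral>x. (\<gamma> (\<iota> x) x)\<^sup>2 \<partial>P)"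
  note int_\<Phi> = integrable_norm_diff_selection[OF \<open>\<iota> \<in> borel \<rightarrow>\<^sub>M count_space UNIV\<close> \<iota>_mem]
  have [measurable]: "(\<lambda>x. \<gamma> (\<iota> x) x) \<in> borel_measurable borel"
    by (rule measurable_compose_countable[where f=\<gamma>]) measurable
  have \<Phi>_lim: "(\<lambda>n. \<Phi> (a (r n))) \<longlonglongrightarrow> G"
    unfolding \<Phi>_def G_def
    by (rule integral_dominated_convergence[OF _ _ w])
       (use near_lim le_w int_\<Phi> in \<open>auto intro!: tendsto_power\<close>)
  have R_lim: "(\<lambda>n. R (a (r n))) \<longlonglongrightarrow> G"
    unfolding R_def G_def
  proof (rule integral_dominated_convergence[OF _ _ w])
    show "AE x in P. norm (sqdist k (a (r n)) x) \<le> w x" for n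
    proof (rule AE_I2)
      show "norm (sqdist k (a (r n)) x) \<le> w x" for x
        using sqdist_le[OF \<iota>_mem, of "a (r n)" x x] le_w[of x n] by (simp add: sqdist_nonneg[OF k])
    qed
  qed (use sqdist_lim in auto)
  \<comment> \<open>So \<open>G\<close> is the infimum of the risk, obtained before any minimiser is
    known to exist.\<close>
  have G_le: "G \<le> R b" for b
  proof (rule field_le_epsilon)
    fix e :: real assume "e > 0"
    then have "\<forall>\<^sub>F n in sequentially. R (a n) \<le> R b + e" unfolding R_def by (rule min)
    then have "\<forall>\<^sub>F n in sequentially. R (a (r n)) \<le> R b + e" using r by (rule eventually_subseq[rotated])
    then show "G \<le> R b + e" by (intro tendsto_upperbound[OF R_lim]) auto
  qed
  have R_le_\<Phi>: "R b \<le> \<Phi> b" for b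
    unfolding R_def \<Phi>_def
    by (intro integral_mono integrable_sqdist[OF k] int_\<Phi> sqdist_le \<iota>_mem)
  define J where "J = {i\<in>{1..k}. measure P {x. \<iota> x = i} > 0}"
  have sets_\<iota>: "{x. \<iota> x = i} \<in> sets P" for i
    using sets_P measurable_sets[OF \<open>\<iota> \<in> borel \<rightarrow>\<^sub>M count_space UNIV\<close>, of "{i}"] by (simp add: vimage_def)
  have cauchy: "Cauchy (\<lambda>n. a (r n) i)" if i: "i \<in> J" for i
  proof (rule ccontr)
    assume "\<not> ?thesis"
    then obtain e where e: "e > 0" and "\<And>N. \<exists>m\<ge>N. \<exists>n\<ge>N. \<not> norm (a (r m) i - a (r n) i) < e"
      unfolding Cauchy_iff by blast
    then obtain p q where pq: "\<And>N. p N \<ge> N" "\<And>N. q N \<ge> N" "\<And>N. norm (a (r (p N)) i - a (r (q N)) i) \<ge> e"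
      by (metis not_less)
    have lp: "filterlim p at_top sequentially" and lq: "filterlim q at_top sequentially"
      using pq by (auto intro: filterlim_at_top_mono[OF filterlim_ident])
    define mid where "mid N j = (1/2) *\<^sub>R (a (r (p N)) j + a (r (q N)) j)" for N j
    \<comment> \<open>The convexity defect of the squared norm at the midpoint. It is nonnegative,
      and its integral tends to 0 because midpoint centres cannot cost less than \<open>G\<close>
      while both ends have costs tending to \<open>G\<close>.\<close>
    define h where "h N x = ((norm (x - a (r (p N)) (\<iota> x)))\<^sup>2 + (norm (x - a (r (q N)) (\<iota> x)))\<^sup>2) / 2
       - (norm (x - mid N (\<iota> x)))\<^sup>2" for N x
    have mid_eq: "x - mid N j = (1/2) *\<^sub>R ((x - a (r (p N)) j) + (x - a (r (q N)) j))" for x N j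
      unfolding mid_def by (simp add: algebra_simps) (simp flip: scaleR_add_left)
    have h0: "h N x \<ge> 0" for N x
    proof -
      define s t where "s = norm (x - a (r (p N)) (\<iota> x))" and "t = norm (x - a (r (q N)) (\<iota> x))"
      have "norm (x - mid N (\<iota> x)) \<le> (s + t) / 2"
        unfolding mid_eq s_def t_def by (simp add: norm_triangle_ineq)
      then have "(norm (x - mid N (\<iota> x)))\<^sup>2 \<le> ((s + t) / 2)\<^sup>2" by (intro power_mono) auto
      also have "\<dots> \<le> (s\<^sup>2 + t\<^sup>2) / 2"
        using zero_le_power2[of "s - t"] by (simp add: power2_eq_square field_simps)
      finally show ?thesis by (simp add: h_def s_def t_def)
    qed
    have int_h: "integrable P (h N)" for N
      unfolding h_def using int_\<Phi> by auto
    have Eh: "(\<integral>x. h N x \<partial>P) \<le> (\<Phi> (a (r (p N))) + \<Phi> (a (r (q N)))) / 2 - G" for N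
    proof -
      have "(\<integral>x. h N x \<partial>P) = (\<Phi> (a (r (p N))) + \<Phi> (a (r (q N)))) / 2 - \<Phi> (mid N)"
        unfolding h_def \<Phi>_def using int_\<Phi> by simp
      then show ?thesis using R_le_\<Phi>[of "mid N"] G_le[of "mid N"] by linarith
    qed
    have "(\<lambda>N. (\<Phi> (a (r (p N))) + \<Phi> (a (r (q N)))) / 2 - G) \<longlonglongrightarrow> (G + G) / 2 - G"
      using filterlim_compose[OF \<Phi>_lim lp] filterlim_compose[OF \<Phi>_lim lq] by (intro tendsto_intros) auto
    then have up: "(\<lambda>N. (\<Phi> (a (r (p N))) + \<Phi> (a (r (q N)))) / 2 - G) \<longlonglongrightarrow> 0" by simp
    have "(\<lambda>N. \<integral>x. norm (h N x) \<partial>P) \<longlonglongrightarrow> 0"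
      by (rule tendsto_sandwich[OF _ _ tendsto_const up]) (use h0 Eh in auto)
    from tendsto_L1_AE_subseq[OF int_h this]
    obtain s where s: "strict_mono s" and AEh: "AE x in P. (\<lambda>N. h (s N) x) \<longlonglongrightarrow> 0" by blast
    \<comment> \<open>Convergence in mean gives almost sure convergence along \<open>s\<close>, and
      the cell of \<open>i\<close> has positive measure, so it contains a point where the defect
      vanishes in the limit. One such point suffices: the centres differ by the same vector seen
      from anywhere.\<close>
    have "\<exists>x. \<iota> x = i \<and> (\<lambda>N. h (s N) x) \<longlonglongrightarrow> 0"
    proof (rule ccontr)
      assume never: "\<not> ?thesis"
      from AEh have "AE x in P. x \<notin> {x. \<iota> x = i}" by eventually_elim (use never in auto)
      then have "measure P {x. \<iota> x = i} = 0" using sets_\<iota> by (simp add: prob_eq_0)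
      then show False using i by (simp add: J_def)
    qed
    then obtain x where x: "\<iota> x = i" and hx: "(\<lambda>N. h (s N) x) \<longlonglongrightarrow> 0" by blast
    have ls: "filterlim s at_top sequentially" by (rule filterlim_subseq[OF s])
    define u v where "u N = x - a (r (p (s N))) i" and "v N = x - a (r (q (s N))) i" for N
    have u: "(\<lambda>N. norm (u N)) \<longlonglongrightarrow> \<gamma> i x" and v: "(\<lambda>N. norm (v N)) \<longlonglongrightarrow> \<gamma> i x"
      unfolding u_def v_def
      using filterlim_compose[OF near_lim[of x] filterlim_compose[OF lp ls]]
        filterlim_compose[OF near_lim[of x] filterlim_compose[OF lq ls]] by (simp_all add: x)
    have "(\<lambda>N. ((norm (u N))\<^sup>2 + (norm (v N))\<^sup>2) / 2 - h (s N) x) \<longlonglongrightarrow> ((\<gamma> i x)\<^sup>2 + (\<gamma> i x)\<^sup>2) / 2 - 0"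
      by (intro tendsto_intros u v hx) simp
    moreover have "((norm (u N))\<^sup>2 + (norm (v N))\<^sup>2) / 2 - h (s N) x = (norm ((1/2) *\<^sub>R (u N + v N)))\<^sup>2" for N
      using mid_eq[of x "s N" i] by (simp add: h_def x u_def v_def)
    ultimately have "(\<lambda>N. sqrt ((norm ((1/2) *\<^sub>R (u N + v N)))\<^sup>2)) \<longlonglongrightarrow> sqrt ((\<gamma> i x)\<^sup>2)"
      by (intro tendsto_real_sqrt) simp
    then have "(\<lambda>N. norm ((1/2) *\<^sub>R (u N + v N))) \<longlonglongrightarrow> \<gamma> i x" using \<gamma>0[of x] x by simp
    from uniformly_convex_midpoint_sequences[OF uc u v this]
    have "\<forall>\<^sub>F N in sequentially. norm (u N - v N) < e"
      using e by (auto simp: tendsto_iff dist_norm)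
    moreover have "norm (u N - v N) \<ge> e" for N
      using pq(3)[of "s N"] by (simp add: u_def v_def norm_minus_commute)
    ultimately show False by (auto simp: not_less[symmetric])
  qed
  define l where "l i = lim (\<lambda>n. a (r n) i)" for i
  have l: "(\<lambda>n. a (r n) i) \<longlonglongrightarrow> l i" if "i \<in> J" for i
    unfolding l_def using Cauchy_convergent[OF cauchy[OF that]] by (simp add: convergent_LIMSEQ_iff)
  have "AE x in P. \<forall>i\<in>{1..k} - J. \<iota> x \<noteq> i"
  proof (intro AE_finite_allI)
    fix i assume "i \<in> {1..k} - J"
    then have "measure P {x. \<iota> x = i} = 0" by (auto simp: J_def zero_less_measure_iff)
    then have "AE x in P. x \<notin> {x. \<iota> x = i}" using sets_\<iota> by (simp add: prob_eq_0)
    then show "AE x in P. \<iota> x \<noteq> i" by simp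
  qed simp
  then have AE_J: "AE x in P. \<iota> x \<in> J" by eventually_elim (use \<iota>_mem in blast)
  have "J \<noteq> {}"
  proof
    assume "J = {}"
    with AE_J have "AE x in P. False" by simp
    then show False by simp
  qed
  moreover have "R b \<le> R c'" if b: "l ` J \<subseteq> b ` {1..k}" for b c'
  proof -
    have "AE x in P. sqdist k b x \<le> (\<gamma> (\<iota> x) x)\<^sup>2"
      using AE_J
    proof eventually_elim
      case (elim x)
      have "(\<lambda>n. norm (x - a (r n) (\<iota> x))) \<longlonglongrightarrow> norm (x - l (\<iota> x))"
        by (intro tendsto_intros l elim)
      then have eq: "\<gamma> (\<iota> x) x = norm (x - l (\<iota> x))" by (rule LIMSEQ_unique[OF near_lim])
      obtain j where "j \<in> {1..k}" "l (\<iota> x) = b j" using b elim by blast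
      then show ?case using sqdist_le[of j k b x] by (simp add: eq)
    qed
    moreover have "integrable P (\<lambda>x. (\<gamma> (\<iota> x) x)\<^sup>2)"
      by (rule integrable_dominated_convergence[OF _ _ w, of _ "\<lambda>n x. (norm (x - a (r n) (\<iota> x)))\<^sup>2"])
         (use near_lim le_w int_\<Phi> in \<open>auto intro!: tendsto_power\<close>)
    ultimately have "R b \<le> G" unfolding R_def G_def using integrable_sqdist[OF k] by (intro integral_mono_AE)
    with G_le[of c'] show ?thesis by linarith
  qed
  moreover have "J \<subseteq> {1..k}" by (auto simp: J_def)
  ultimately show ?thesis using that[of r J l] r l unfolding R_def by blast
qed

subsection \<open>Hausdorff and Gromov-Hausdorff limits\<close>

lemma hausdorff_dist_le:
  assumes "e > 0" "A \<subseteq> M" "C \<subseteq> M"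
    and "\<And>x. x \<in> A \<Longrightarrow> \<exists>y\<in>C. d y x \<le> e" "\<And>y. y \<in> C \<Longrightarrow> \<exists>x\<in>A. d x y \<le> e"
  shows "hausdorff_dist M d A C \<le> e"
  unfolding hausdorff_dist_def using assms
  by (intro cInf_lower bdd_belowI[of _ 0]) (auto simp: enlargement_def subset_iff)

text \<open>The infimum of the empty set of reals carries no information, so an admissible radius
  must be exhibited. Both orders of arguments enter the maximum because \<open>d\<close> is an
  arbitrary function here.\<close>

lemma hausdorff_dist_nonneg:
  assumes "finite A" "finite C" "A \<noteq> {}" "C \<noteq> {}" "A \<subseteq> M" "C \<subseteq> M"
  shows "hausdorff_dist M d A C \<ge> 0"
proof -
  define e where "e = Max (insert 1 (case_prod d ` ((A \<times> C) \<union> (C \<times> A))))"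
  have fin: "finite (insert 1 (case_prod d ` ((A \<times> C) \<union> (C \<times> A))))" using assms by auto
  have "e \<ge> 1" unfolding e_def using fin by (intro Max_ge) auto
  moreover have "d x y \<le> e" if "(x, y) \<in> (A \<times> C) \<union> (C \<times> A)" for x y
    unfolding e_def using that by (intro Max_ge fin insertI2 image_eqI[of _ _ "(x, y)"]) auto
  moreover obtain x0 y0 where "x0 \<in> A" "y0 \<in> C" using assms(3,4) by blast
  ultimately have "e \<in> {\<epsilon>. \<epsilon> > 0 \<and> A \<subseteq> enlargement M d C \<epsilon> \<and> C \<subseteq> enlargement M d A \<epsilon>}"
    using assms(5,6) by (auto simp: enlargement_def)
  then show ?thesis unfolding hausdorff_dist_def by (intro cInf_greatest) auto
qed

text \<open>Boundedness provides an admissible radius, so that an infimum below \<open>e\<close> is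
  undercut by a radius that is really attained.\<close>

lemma dH_less_imp_near:
  assumes "bounded A" "bounded C" "A \<noteq> {}" "C \<noteq> {}" "dH A C < e"
  shows "\<And>x. x \<in> A \<Longrightarrow> \<exists>y\<in>C. dist y x < e" "\<And>y. y \<in> C \<Longrightarrow> \<exists>x\<in>A. dist x y < e"
proof -
  let ?S = "{\<epsilon>. \<epsilon> > 0 \<and> A \<subseteq> enlargement UNIV dist C \<epsilon> \<and> C \<subseteq> enlargement UNIV dist A \<epsilon>}"
  obtain B where B: "\<And>x y. x \<in> A \<union> C \<Longrightarrow> y \<in> A \<union> C \<Longrightarrow> dist x y \<le> B"
    using bounded_two_points[of "A \<union> C"] assms(1,2) by auto
  have B1: "dist x y \<le> max B 1" if "x \<in> A \<union> C" "y \<in> A \<union> C" for x y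
    using B[OF that] by simp
  obtain x0 y0 where "x0 \<in> A" "y0 \<in> C" using assms(3,4) by blast
  then have "max B 1 \<in> ?S" using B1 by (auto simp: enlargement_def)
  then have "?S \<noteq> {}" by blast
  with assms(5) obtain \<epsilon> where "\<epsilon> \<in> ?S" "\<epsilon> < e"
    unfolding hausdorff_dist_def using cInf_lessD[of ?S e] by blast
  then have \<epsilon>: "\<And>x. x \<in> A \<Longrightarrow> \<exists>y\<in>C. dist y x \<le> \<epsilon>" "\<And>y. y \<in> C \<Longrightarrow> \<exists>x\<in>A. dist x y \<le> \<epsilon>"
    by (auto simp: enlargement_def subset_iff)
  show "\<exists>y\<in>C. dist y x < e" if "x \<in> A" for x
    using \<epsilon>(1)[OF that] \<open>\<epsilon> < e\<close> by force
  show "\<exists>x\<in>A. dist x y < e" if "y \<in> C" for y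
    using \<epsilon>(2)[OF that] \<open>\<epsilon> < e\<close> by force
qed

lemma GH_dist_bounds:
  fixes A C :: "'a::metric_space set"
  assumes fin: "finite A" "finite C" and ne: "A \<noteq> {}" "C \<noteq> {}"
  shows GH_dist_nonneg: "GH_dist A C \<ge> 0"
    and GH_dist_le_isometry: "isometry T \<Longrightarrow> e > 0 \<Longrightarrow> (\<And>x. x \<in> A \<Longrightarrow> \<exists>y\<in>T ` C. dist y x \<le> e) \<Longrightarrow>
          (\<And>y. y \<in> T ` C \<Longrightarrow> \<exists>x\<in>A. dist x y \<le> e) \<Longrightarrow> GH_dist A C \<le> e"
proof -
  have mem: "hausdorff_dist (A \<union> T ` C) dist (id ` A) (T ` C) \<in> gh_distances TYPE(real) A C"
    if "isometry T" for T :: "'a \<Rightarrow> 'a"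
  proof -
    interpret N: Metric_space "A \<union> T ` C" dist
      by unfold_locales (auto simp: dist_commute dist_triangle)
    have "compact_space N.mtopology"
      using fin by (simp add: compact_space_def finite_imp_compactin)
    then have "hausdorff_dist (A \<union> T ` C) dist (id ` A) (T ` C) \<in> gh_distances TYPE('a) A C"
      unfolding gh_distances_def using N.Metric_space_axioms that
      by (intro CollectI exI[of _ "A \<union> T ` C"] exI[of _ dist] exI[of _ id] exI[of _ T])
         (auto simp: isometric_embedding_def isometry_def)
    then show ?thesis using gh_distances_subset_real by blast
  qed
  have pos: "t \<ge> 0" if t: "t \<in> gh_distances TYPE(real) A C" for t
  proof -
    obtain M :: "real set" and d T S where "t = hausdorff_dist M d (T ` A) (S ` C)" "T ` A \<subseteq> M" "S ` C \<subseteq> M"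
      using t unfolding gh_distances_def isometric_embedding_def mem_Collect_eq
      by (elim exE conjE) (rule that)
    then show ?thesis using fin ne by (auto intro!: hausdorff_dist_nonneg)
  qed
  have "gh_distances TYPE(real) A C \<noteq> {}"
    using mem[of id] by (auto simp: isometry_def)
  then show "GH_dist A C \<ge> 0"
    unfolding GH_dist_def using pos by (intro cInf_greatest)
  assume T: "isometry T" and e: "e > 0" and "\<And>x. x \<in> A \<Longrightarrow> \<exists>y\<in>T ` C. dist y x \<le> e"
    "\<And>y. y \<in> T ` C \<Longrightarrow> \<exists>x\<in>A. dist x y \<le> e"
  then have "hausdorff_dist (A \<union> T ` C) dist (id ` A) (T ` C) \<le> e"
    by (intro hausdorff_dist_le) auto
  moreover have "GH_dist A C \<le> hausdorff_dist (A \<union> T ` C) dist (id ` A) (T ` C)"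
    unfolding GH_dist_def using mem[OF T] pos by (intro cInf_lower bdd_belowI[of _ 0])
  ultimately show "GH_dist A C \<le> e" by linarith
qed

lemma compact_finitely_many_convergent_subsequences:
  fixes y :: "nat \<Rightarrow> nat \<Rightarrow> 'a::metric_space"
  assumes "compact A" and "\<And>n i. y n i \<in> A"
  shows "\<exists>s l. strict_mono s \<and> (\<forall>i\<le>k::nat. l i \<in> A \<and> (\<lambda>n. y (s n) i) \<longlonglongrightarrow> l i)"
proof (induction k)
  case 0
  obtain l s where "l \<in> A" "strict_mono s" "((\<lambda>n. y n 0) \<circ> s) \<longlonglongrightarrow> l"
    using seq_compactE[of A "\<lambda>n. y n 0"] assms compact_imp_seq_compact by metis
  then show ?case by (auto simp: comp_def intro!: exI[of _ s] exI[of _ "\<lambda>_. l"])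
next
  case (Suc k)
  then obtain s l where s: "strict_mono s" and l: "\<And>i. i \<le> k \<Longrightarrow> l i \<in> A \<and> (\<lambda>n. y (s n) i) \<longlonglongrightarrow> l i" by blast
  obtain l' s' where s': "l' \<in> A" "strict_mono s'" "((\<lambda>n. y (s n) (Suc k)) \<circ> s') \<longlonglongrightarrow> l'"
    using seq_compactE[of A "\<lambda>n. y (s n) (Suc k)"] assms compact_imp_seq_compact by metis
  have "(\<lambda>n. y ((s \<circ> s') n) i) \<longlonglongrightarrow> (l(Suc k := l')) i \<and> (l(Suc k := l')) i \<in> A" if "i \<le> Suc k" for i
    using that l[of i] s' LIMSEQ_subseq_LIMSEQ[of "\<lambda>n. y (s n) i" "l i" s']
    by (cases "i = Suc k") (auto simp: comp_def)
  with strict_mono_o[OF s s'(2)] show ?case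
    by (intro exI[of _ "s \<circ> s'"] exI[of _ "l(Suc k := l')"]) (auto simp: comp_def)
qed

lemma isometry_inj: "isometry T \<Longrightarrow> inj T"
  unfolding isometry_def inj_def by (metis dist_eq_0_iff)

section \<open>Limit sets of minimising sequences\<close>

context square_integrable_distribution
begin

lemma kmeans_setI:
  assumes "k \<ge> 1" "\<And>c. (\<integral>x. sqdist k b x \<partial>P) \<le> (\<integral>x. sqdist k c x \<partial>P)"
  shows "b ` {1..k} \<in> kmeans_sets P k"
  using assms unfolding kmeans_sets_def by (auto simp: kmeans_risk_le_iff)

text \<open>Hausdorff convergence to a compact set makes every centre converge along a subsequence,
  including those that serve nothing in the limit: each is shadowed by a point of \<open>A\<close>.
  Hence \<open>A\<close> is the set of all limits, and it contains the limits that already attain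
  the infimum.\<close>

lemma minimizing_sequence_adherent_point:
  fixes a :: "nat \<Rightarrow> nat \<Rightarrow> 'a"
  assumes uc: "uniformly_convex TYPE('a)" and k: "k \<ge> 1"
    and min: "\<And>b e. e > 0 \<Longrightarrow> \<forall>\<^sub>F n in sequentially. (\<integral>x. sqdist k (a n) x \<partial>P) \<le> (\<integral>x. sqdist k b x \<partial>P) + e"
    and adh: "dH_adherent_point S A" and S: "\<And>n. n \<ge> 1 \<Longrightarrow> S n = a n ` {1..k}"
  shows "A \<in> kmeans_sets P k"
proof -
  obtain r0 where A: "compact A" "A \<noteq> {}" and r0: "strict_mono r0" "(\<lambda>j. dH (S (r0 j)) A) \<longlonglongrightarrow> 0"
    using adh by (auto simp: dH_adherent_point_def hyperspace_def)
  \<comment> \<open>The shift keeps the indices at least 1, where \<open>S\<close> is known to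
    consist of the centres.\<close>
  define r where "r = r0 \<circ> Suc"
  have r: "strict_mono r" unfolding r_def using r0(1) by (simp add: strict_mono_def)
  have r1: "r j \<ge> 1" for j
    using seq_suble[OF r0(1), of "Suc j"] by (simp add: r_def)
  \<comment> \<open>The summand \<open>1 / Suc j\<close> provides the strict inequality that
    \<open>dH_less_imp_near\<close> asks for.\<close>
  define \<delta> where "\<delta> j = \<bar>dH (a (r j) ` {1..k}) A\<bar> + 1 / Suc j" for j
  have "(\<lambda>j. dH (a (r j) ` {1..k}) A) \<longlonglongrightarrow> 0"
    using LIMSEQ_Suc[OF r0(2)] S[OF r1] by (simp add: r_def)
  then have "\<delta> \<longlonglongrightarrow> \<bar>0\<bar> + 0"
    unfolding \<delta>_def using LIMSEQ_inverse_real_of_nat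
    by (intro tendsto_intros) (auto simp: inverse_eq_divide)
  then have \<delta>: "\<delta> \<longlonglongrightarrow> 0" by simp
  have dH\<delta>: "dH (a (r j) ` {1..k}) A < \<delta> j" for j
    unfolding \<delta>_def by (simp add: add_strict_increasing2 le_less_trans[OF abs_ge_self])
  note near = dH_less_imp_near[OF _ compact_imp_bounded[OF A(1)] _ A(2) dH\<delta>]
  \<comment> \<open>For \<open>i\<close> outside \<open>{1..k}\<close> any point of \<open>A\<close>
    is taken, so that \<open>y\<close> has all its values in the compact set.\<close>
  have ex_y: "\<exists>y\<in>A. i \<in> {1..k} \<longrightarrow> dist y (a (r j) i) < \<delta> j" for i j
    using near(1)[of j "a (r j) i"] k A(2) by (cases "i \<in> {1..k}") (auto simp: finite_imp_bounded)
  define y where "y j i = (SOME y. y \<in> A \<and> (i \<in> {1..k} \<longrightarrow> dist y (a (r j) i) < \<delta> j))" for i j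
  have y: "y j i \<in> A" "i \<in> {1..k} \<Longrightarrow> dist (y j i) (a (r j) i) < \<delta> j" for i j
    using someI_ex[OF ex_y[of i j, unfolded Bex_def]] unfolding y_def by blast+
  obtain s l where s: "strict_mono s" and l: "\<And>i. i \<le> k \<Longrightarrow> l i \<in> A" "\<And>i. i \<le> k \<Longrightarrow> (\<lambda>n. y (s n) i) \<longlonglongrightarrow> l i"
    using compact_finitely_many_convergent_subsequences[of A y k, OF A(1) y(1)] by metis
  have \<delta>s: "(\<lambda>n. \<delta> (s n)) \<longlonglongrightarrow> 0"
    using LIMSEQ_subseq_LIMSEQ[OF \<delta> s] by (simp add: comp_def)
  have al: "(\<lambda>n. a (r (s n)) i) \<longlonglongrightarrow> l i" if i: "i \<in> {1..k}" for i
  proof (rule Lim_transform[of "\<lambda>n. y (s n) i"])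
    show "(\<lambda>n. y (s n) i) \<longlonglongrightarrow> l i" using l(2) i by simp
    have "norm (a (r (s n)) i - y (s n) i) \<le> \<delta> (s n)" for n
      using y(2)[OF i, of "s n"] by (simp add: dist_norm norm_minus_commute)
    then show "(\<lambda>n. a (r (s n)) i - y (s n) i) \<longlonglongrightarrow> 0"
      by (intro Lim_null_comparison[OF _ \<delta>s]) auto
  qed
  have "A \<subseteq> l ` {1..k}"
  proof
    fix z assume z: "z \<in> A"
    show "z \<in> l ` {1..k}"
    proof (rule ccontr)
      assume "z \<notin> l ` {1..k}"
      then have "\<forall>\<^sub>F n in sequentially. 0 < dist (a (r (s n)) i) z - \<delta> (s n)" if "i \<in> {1..k}" for i
        using that by (intro order_tendstoD(1)[OF tendsto_diff[OF tendsto_dist[OF al tendsto_const] \<delta>s]]) auto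
      then have "\<forall>\<^sub>F n in sequentially. \<forall>i\<in>{1..k}. 0 < dist (a (r (s n)) i) z - \<delta> (s n)"
        by (intro eventually_ball_finite) auto
      then obtain n where "\<forall>i\<in>{1..k}. 0 < dist (a (r (s n)) i) z - \<delta> (s n)"
        using eventually_happens'[OF sequentially_bot] by blast
      then have n: "\<delta> (s n) < dist (a (r (s n)) i) z" if "i \<in> {1..k}" for i using that by force
      obtain x where "x \<in> a (r (s n)) ` {1..k}" "dist x z < \<delta> (s n)"
        using near(2)[OF _ _ z, of "s n"] k by (auto simp: finite_imp_bounded)
      with n show False by fastforce
    qed
  qed
  then have Al: "A = l ` {1..k}" using l(1) by auto
  define t where "t = r \<circ> s"
  have t: "strict_mono t" unfolding t_def using r s by (rule strict_mono_o)
  have "\<forall>\<^sub>F n in sequentially. (\<integral>x. sqdist k (a (t n)) x \<partial>P) \<le> (\<integral>x. sqdist k b x \<partial>P) + e" if "e > 0" for b e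
    using min[OF that] t by (rule eventually_subseq[rotated])
  from minimizing_sequence_subsequence[OF uc k this]
  obtain q J l' where q: "strict_mono q" "J \<subseteq> {1..k}"
    and l': "\<And>i. i \<in> J \<Longrightarrow> (\<lambda>n. a (t (q n)) i) \<longlonglongrightarrow> l' i"
    and opt: "\<And>b c. l' ` J \<subseteq> b ` {1..k} \<Longrightarrow> (\<integral>x. sqdist k b x \<partial>P) \<le> (\<integral>x. sqdist k c x \<partial>P)"
    by metis
  have "l' i = l i" if "i \<in> J" for i
    using LIMSEQ_unique[OF l'[OF that]] LIMSEQ_subseq_LIMSEQ[OF al q(1), of i] that q(2)
    by (auto simp: t_def comp_def)
  then have "l' ` J \<subseteq> l ` {1..k}" using q(2) by auto
  then show ?thesis unfolding Al by (intro kmeans_setI[OF k] opt)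
qed

text \<open>A subsequence staying at distance \<open>e\<close> from \<open>K0\<close> is refuted:
  along a further one all centres converge, their limits form a minimising set, and an isometry
  carries \<open>K0\<close> onto it.\<close>

lemma minimizing_sequence_GH_limit:
  fixes a :: "nat \<Rightarrow> nat \<Rightarrow> 'a"
  assumes uc: "uniformly_convex TYPE('a)" and k: "k \<ge> 1"
    and min: "\<And>b e. e > 0 \<Longrightarrow> \<forall>\<^sub>F n in sequentially. (\<integral>x. sqdist k (a n) x \<partial>P) \<le> (\<integral>x. sqdist k b x \<partial>P) + e"
    and iso: "\<And>K1 K2. K1 \<in> kmeans_sets P k \<Longrightarrow> K2 \<in> kmeans_sets P k \<Longrightarrow> \<exists>T::'a \<Rightarrow> 'a. isometry T \<and> T ` K2 = K1"
    and K0: "K0 \<in> kmeans_sets P k"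
  shows "(\<lambda>n. GH_dist (a n ` {1..k}) K0) \<longlonglongrightarrow> 0"
proof (rule ccontr)
  have fin0: "finite K0" "K0 \<noteq> {}" using K0 k by (auto simp: kmeans_sets_def)
  have fin: "finite (a n ` {1..k})" "a n ` {1..k} \<noteq> {}" for n using k by auto
  assume "\<not> ?thesis"
  then obtain e where e: "e > 0" and often: "\<not> (\<forall>\<^sub>F n in sequentially. GH_dist (a n ` {1..k}) K0 < e)"
    using GH_dist_nonneg[OF fin(1) fin0(1) fin(2) fin0(2)] by (auto simp: tendsto_iff dist_real_def)
  from not_eventually_sequentiallyD[OF often]
  obtain s :: "nat \<Rightarrow> nat" where s: "strict_mono s" and "\<forall>n. \<not> GH_dist (a (s n) ` {1..k}) K0 < e" by blast
  then have far: "GH_dist (a (s n) ` {1..k}) K0 \<ge> e" for n by (simp add: not_less)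
  have "\<forall>\<^sub>F n in sequentially. (\<integral>x. sqdist k (a (s n)) x \<partial>P) \<le> (\<integral>x. sqdist k b x \<partial>P) + e" if "e > 0" for b e
    using min[OF that] s by (rule eventually_subseq[rotated])
  from minimizing_sequence_subsequence[OF uc k this]
  obtain r :: "nat \<Rightarrow> nat" and J l where r: "strict_mono r" and J: "J \<subseteq> {1..k}" "J \<noteq> {}"
    and l: "\<And>i. i \<in> J \<Longrightarrow> (\<lambda>n. a (s (r n)) i) \<longlonglongrightarrow> l i"
    and opt: "\<And>b c. l ` J \<subseteq> b ` {1..k} \<Longrightarrow> (\<integral>x. sqdist k b x \<partial>P) \<le> (\<integral>x. sqdist k c x \<partial>P)"
    by metis
  have "(\<lambda>n. a (s (r n)) i) \<longlonglongrightarrow> l i" if i: "i \<in> {1..k}" for i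
  proof (cases "J = {1..k}")
    case False
    have finJ: "finite (l ` J)" using J(1) finite_subset by blast
    obtain j m where j: "j \<in> J" and m: "m \<in> {1..k}" "m \<notin> J" using J False by blast
    have "(UNIV :: 'a set) = l ` J"
    proof (rule ccontr)
      \<comment> \<open>An unused centre may be put anywhere, which gives minimisers of different cardinalities.\<close>
      assume "UNIV \<noteq> l ` J"
      then obtain x where x: "x \<notin> l ` J" by blast
      define b where "b y i = (if i \<in> J then l i else y)" for y i
      have im: "b y ` {1..k} = insert y (l ` J)" for y
        using J(1) m by (auto simp: b_def)
      have opt': "insert y (l ` J) \<in> kmeans_sets P k" for y
        unfolding im[symmetric] by (intro kmeans_setI[OF k] opt) (unfold im, auto)
      obtain T :: "'a \<Rightarrow> 'a" where T: "isometry T" "T ` insert x (l ` J) = insert (l j) (l ` J)"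
        using iso[OF opt' opt'] by blast
      have "card (insert x (l ` J)) = card (insert (l j) (l ` J))"
        unfolding T(2)[symmetric] using isometry_inj[OF T(1)]
        by (intro card_image[symmetric]) (rule inj_on_subset, auto)
      then show False using x j finJ by (simp add: insert_absorb)
    qed
    then have "finite (UNIV :: 'a set)" using finJ by simp
    have "y = 0" for y :: 'a
    proof (rule ccontr)
      assume "y \<noteq> 0"
      then have "inj (\<lambda>n::nat. real n *\<^sub>R y)" by (auto intro!: injI)
      then show False using \<open>finite (UNIV :: 'a set)\<close> by (meson finite_imageD finite_subset infinite_UNIV_nat subset_UNIV)
    qed
    then have "a (s (r n)) i = l i" for n by metis
    then show ?thesis by simp
  qed (use l i in auto)
  then have lim: "(\<lambda>n. a (s (r n)) i) \<longlonglongrightarrow> l i" if "i \<in> {1..k}" for i using that .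
  have "l ` {1..k} \<in> kmeans_sets P k"
    using J(1) by (intro kmeans_setI[OF k] opt) auto
  then obtain T where T: "isometry T" "T ` K0 = l ` {1..k}" using iso[OF _ K0] by blast
  have "\<forall>\<^sub>F n in sequentially. \<forall>i\<in>{1..k}. dist (a (s (r n)) i) (l i) < e / 2"
    using e by (intro eventually_ball_finite ballI tendstoD[OF lim]) auto
  then obtain n where n: "\<forall>i\<in>{1..k}. dist (a (s (r n)) i) (l i) < e / 2"
    using eventually_happens'[OF sequentially_bot] by blast
  have "GH_dist (a (s (r n)) ` {1..k}) K0 \<le> e / 2"
    by (rule GH_dist_le_isometry[OF fin(1) fin0(1) fin(2) fin0(2) T(1)], unfold T(2))
       (use e n in \<open>force simp: dist_commute intro: less_imp_le\<close>)+
  with far[of "r n"] e show False by simp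
qed

end

section \<open>Transfer to the random k-means sets\<close>

theorem theorem1:
  fixes M :: "'w measure"
    and X :: "'w \<Rightarrow> 'a::{banach, second_countable_topology}"
    and Xs :: "nat \<Rightarrow> 'w \<Rightarrow> 'a"
    and P :: "'a measure"
    and k :: nat
    and K :: "nat \<Rightarrow> 'w \<Rightarrow> 'a set"
  assumes uc: "uniformly_convex TYPE('a)"
    and k: "k \<ge> 1"
    and M: "prob_space M"
    and X: "X \<in> borel_measurable M"
    and P: "P = distr M borel X"
    and moment: "integrable M (\<lambda>\<omega>. (norm (X \<omega>))\<^sup>2)"
    and indep: "prob_space.indep_vars M (\<lambda>_. borel) Xs {1..}"
    and distr: "\<And>i. i \<ge> 1 \<Longrightarrow> distr M borel (Xs i) = P"
    and K: "\<And>n \<omega>. n \<ge> 1 \<Longrightarrow> \<omega> \<in> space M \<Longrightarrow>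
              K n \<omega> \<in> kmeans_sets (empirical_measure n (\<lambda>i. Xs i \<omega>)) k"
  shows "(AE \<omega> in M. \<forall>A. dH_adherent_point (\<lambda>n. K n \<omega>) A \<longrightarrow> A \<in> kmeans_sets P k) \<and>
         ((\<forall>K1\<in>kmeans_sets P k. \<forall>K2\<in>kmeans_sets P k.
             \<exists>T::'a \<Rightarrow> 'a. isometry T \<and> T ` K2 = K1) \<longrightarrow>
          (\<forall>K0\<in>kmeans_sets P k. \<exists>r::nat \<Rightarrow> nat. strict_mono r \<and>
             (AE \<omega> in M. (\<lambda>j. GH_dist (K (r j) \<omega>) K0) \<longlonglongrightarrow> 0)))"
proof -
  interpret M: prob_space M by fact
  interpret P: prob_space P
    unfolding P using X by (rule M.prob_space_distr)
  interpret P: square_integrable_distribution P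
  proof
    show "sets P = sets borel" by (simp add: P)
    show "integrable P (\<lambda>x. (norm x)\<^sup>2)"
      using moment X unfolding P by (subst integrable_distr_eq) auto
  qed
  \<comment> \<open>The centres are picked sample by sample; for \<open>n = 0\<close> or outside
    \<open>space M\<close> the choice is arbitrary.\<close>
  define center where
    "center n \<omega> = (SOME a. K n \<omega> = a ` {1..k} \<and>
       (\<forall>b. (\<Sum>i=1..n. sqdist k a (Xs i \<omega>)) \<le> (\<Sum>i=1..n. sqdist k b (Xs i \<omega>))))" for n \<omega>
  have center: "K n \<omega> = center n \<omega> ` {1..k} \<and>
      (\<forall>b. (\<Sum>i=1..n. sqdist k (center n \<omega>) (Xs i \<omega>)) \<le> (\<Sum>i=1..n. sqdist k b (Xs i \<omega>)))"
    if n: "n \<ge> 1" and \<omega>: "\<omega> \<in> space M" for n \<omega>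
  proof -
    obtain a where "K n \<omega> = a ` {1..k}"
      "\<And>b. (\<Sum>i=1..n. sqdist k a (Xs i \<omega>)) \<le> (\<Sum>i=1..n. sqdist k b (Xs i \<omega>))"
      by (rule kmeans_set_empirical_measureE[OF n k K[OF n \<omega>]]) (rule that)
    then have "\<exists>a. K n \<omega> = a ` {1..k} \<and>
       (\<forall>b. (\<Sum>i=1..n. sqdist k a (Xs i \<omega>)) \<le> (\<Sum>i=1..n. sqdist k b (Xs i \<omega>)))" by blast
    from someI_ex[OF this] show ?thesis unfolding center_def .
  qed
  have min: "AE \<omega> in M. \<forall>b. \<forall>e>0. \<forall>\<^sub>F n in sequentially.
      (\<integral>y. sqdist k (center n \<omega>) y \<partial>P) \<le> (\<integral>y. sqdist k b y \<partial>P) + e"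
  proof -
    have "AE \<omega> in M. \<forall>a. (\<forall>n\<ge>1. \<forall>b. (\<Sum>i=1..n. sqdist k (a n) (Xs i \<omega>)) \<le> (\<Sum>i=1..n. sqdist k b (Xs i \<omega>)))
        \<longrightarrow> (\<forall>b. \<forall>e>0. \<forall>\<^sub>F n in sequentially. (\<integral>y. sqdist k (a n) y \<partial>P) \<le> (\<integral>y. sqdist k b y \<partial>P) + e)"
      by (rule M.AE_empirical_minimizers_minimize_risk[OF P.square_integrable_distribution_axioms k indep distr])
    then show ?thesis
      using AE_space
    proof eventually_elim
      case (elim \<omega>)
      then show ?case using center by (blast dest: spec[of _ "\<lambda>n. center n \<omega>"])
    qed
  qed
  show ?thesis
  proof (intro conjI impI ballI)
    show "AE \<omega> in M. \<forall>A. dH_adherent_point (\<lambda>n. K n \<omega>) A \<longrightarrow> A \<in> kmeans_sets P k"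
      using min AE_space
    proof eventually_elim
      case (elim \<omega>)
      show ?case
      proof (intro allI impI)
        fix A assume "dH_adherent_point (\<lambda>n. K n \<omega>) A"
        then show "A \<in> kmeans_sets P k"
        proof (rule P.minimizing_sequence_adherent_point[OF uc k, where a="\<lambda>n. center n \<omega>", rotated])
          show "K n \<omega> = center n \<omega> ` {1..k}" if "n \<ge> 1" for n
            using center[OF that elim(2)] by blast
        qed (use elim(1) in blast)
      qed
    qed
  next
    fix K0
    assume iso: "\<forall>K1\<in>kmeans_sets P k. \<forall>K2\<in>kmeans_sets P k. \<exists>T::'a \<Rightarrow> 'a. isometry T \<and> T ` K2 = K1"
      and K0: "K0 \<in> kmeans_sets P k"
    \<comment> \<open>The whole sequence converges; \<open>id\<close> is written in as the witness
      for the required subsequence.\<close>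
    have "AE \<omega> in M. (\<lambda>n. GH_dist (K (id n) \<omega>) K0) \<longlonglongrightarrow> 0"
      using min AE_space
    proof eventually_elim
      case (elim \<omega>)
      have "(\<lambda>n. GH_dist (center n \<omega> ` {1..k}) K0) \<longlonglongrightarrow> 0"
      proof (rule P.minimizing_sequence_GH_limit[OF uc k _ _ K0])
        show "\<forall>\<^sub>F n in sequentially. (\<integral>y. sqdist k (center n \<omega>) y \<partial>P) \<le> (\<integral>y. sqdist k b y \<partial>P) + e"
          if "e > 0" for b e using elim(1) that by blast
      qed (use iso in blast)
      moreover have "\<forall>\<^sub>F n in sequentially. GH_dist (center n \<omega> ` {1..k}) K0 = GH_dist (K (id n) \<omega>) K0"
        using eventually_ge_at_top[of 1] by eventually_elim (use center elim in simp)
      ultimately show ?case by (rule Lim_transform_eventually)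
    qed
    then show "\<exists>r::nat \<Rightarrow> nat. strict_mono r \<and> (AE \<omega> in M. (\<lambda>j. GH_dist (K (r j) \<omega>) K0) \<longlonglongrightarrow> 0)"
      using strict_mono_id by (intro exI[of _ id]) auto
  qed
qed

end
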